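(* Let $X$ be the Cantor set, let $T\colon X\to X$ be a minimal homeomorphism, and let $\mu$ be a $T$-invariant Borel probability measure on $X$. Let $[[T]]$ be the topological full group of $T$, let $[[T]]'$ be its commutator subgroup, and let $\pi\colon [[T]]\to B(L^2(X,\mu))$ be the Koopman representation associated to the action of $[[T]]$ on $(X,\mu)$. Then $C^*_\pi([[T]])=C^*_\pi([[T]]')$.
   Context: The topological full group $[[T]]$ is the group of all homeomorphisms $\gamma$ of $X$ for which there exist a finite partition of $X$ into clopen sets $A_1,\dots,A_n$ and integers $k_1,\dots,k_n$ such that $\gamma|_{A_i}=T^{k_i}|_{A_i}$ for $1\le i\le n$. The measure $\mu$ is invariant under $[[T]]$. The Koopman representation $\pi$ is the unitary representation given by $\pi(g)(f):=f\circ g^{-1}$ for $g\in[[T]]$, $f\in L^2(X,\mu)$. For a unitary representation $\rho$ of a group $G$ on a Hilbert space $H$, $C^*_\rho(G)\subset B(H)$ denotes the $C^*$-algebra generated by $\rho(G)$; $C^*_\pi([[T]]')$ is the $C^*$-algebra generated by $\pi([[T]]')$. *)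

theory Defs
  imports "HOL-Probability.Probability" "HOL-Algebra.Generated_Groups"
begin

section \<open>Operators on a complex Hilbert space\<close>

record 'v cinner_space =
  hcarrier :: "'v set"
  hadd :: "'v \<Rightarrow> 'v \<Rightarrow> 'v"
  hscale :: "complex \<Rightarrow> 'v \<Rightarrow> 'v"
  hinner :: "'v \<Rightarrow> 'v \<Rightarrow> complex"

definition hnorm :: "'v cinner_space \<Rightarrow> 'v \<Rightarrow> real" where
  "hnorm H x = sqrt (Re (hinner H x x))"

text \<open>Operators are functions that are \<^const>\<open>undefined\<close> outside the carrier, so that
  equality of operators is equality on the carrier.\<close>

definition bounded_ops :: "'v cinner_space \<Rightarrow> ('v \<Rightarrow> 'v) set" where
  "bounded_ops H = {a \<in> hcarrier H \<rightarrow>\<^sub>E hcarrier H.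
     (\<forall>x\<in>hcarrier H. \<forall>y\<in>hcarrier H. a (hadd H x y) = hadd H (a x) (a y)) \<and>
     (\<forall>c. \<forall>x\<in>hcarrier H. a (hscale H c x) = hscale H c (a x)) \<and>
     (\<exists>C. \<forall>x\<in>hcarrier H. hnorm H (a x) \<le> C * hnorm H x)}"

definition op_add :: "'v cinner_space \<Rightarrow> ('v \<Rightarrow> 'v) \<Rightarrow> ('v \<Rightarrow> 'v) \<Rightarrow> 'v \<Rightarrow> 'v" where
  "op_add H a b = (\<lambda>x\<in>hcarrier H. hadd H (a x) (b x))"

definition op_scale :: "'v cinner_space \<Rightarrow> complex \<Rightarrow> ('v \<Rightarrow> 'v) \<Rightarrow> 'v \<Rightarrow> 'v" where
  "op_scale H c a = (\<lambda>x\<in>hcarrier H. hscale H c (a x))"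

definition op_norm :: "'v cinner_space \<Rightarrow> ('v \<Rightarrow> 'v) \<Rightarrow> real" where
  "op_norm H a = (SUP x\<in>{x \<in> hcarrier H. hnorm H x \<le> 1}. hnorm H (a x))"

definition op_dist :: "'v cinner_space \<Rightarrow> ('v \<Rightarrow> 'v) \<Rightarrow> ('v \<Rightarrow> 'v) \<Rightarrow> real" where
  "op_dist H a b = op_norm H (op_add H a (op_scale H (- 1) b))"

definition is_adjoint :: "'v cinner_space \<Rightarrow> ('v \<Rightarrow> 'v) \<Rightarrow> ('v \<Rightarrow> 'v) \<Rightarrow> bool" where
  "is_adjoint H a b \<longleftrightarrow>
     (\<forall>x\<in>hcarrier H. \<forall>y\<in>hcarrier H. hinner H (a x) y = hinner H x (b y))"

text \<open>A \<open>C\<^sup>*\<close>-subalgebra of \<open>B(H)\<close> is a non-empty norm-closed subset that is closed under the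
  algebra operations and under adjoints.  Adjoints are given by a relation; on a Hilbert space every
  bounded operator has exactly one.  The ambient space in the definitions below is meant to be a
  Hilbert space.\<close>

definition cstar_subalgebra :: "'v cinner_space \<Rightarrow> ('v \<Rightarrow> 'v) set \<Rightarrow> bool" where
  "cstar_subalgebra H A \<longleftrightarrow>
     A \<noteq> {} \<and> A \<subseteq> bounded_ops H \<and>
     (\<forall>a\<in>A. \<forall>b\<in>A. op_add H a b \<in> A) \<and>
     (\<forall>c. \<forall>a\<in>A. op_scale H c a \<in> A) \<and>
     (\<forall>a\<in>A. \<forall>b\<in>A. compose (hcarrier H) a b \<in> A) \<and>
     (\<forall>a\<in>A. \<forall>b\<in>bounded_ops H. is_adjoint H a b \<longrightarrow> b \<in> A) \<and>
     (\<forall>a\<in>bounded_ops H. (\<forall>\<epsilon>>0. \<exists>b\<in>A. op_dist H a b < \<epsilon>) \<longrightarrow> a \<in> A)"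

definition cstar_generated :: "'v cinner_space \<Rightarrow> ('v \<Rightarrow> 'v) set \<Rightarrow> ('v \<Rightarrow> 'v) set" where
  "cstar_generated H S = \<Inter>{A. cstar_subalgebra H A \<and> S \<subseteq> A}"

definition cstar_rep :: "'v cinner_space \<Rightarrow> ('g \<Rightarrow> 'v \<Rightarrow> 'v) \<Rightarrow> 'g set \<Rightarrow> ('v \<Rightarrow> 'v) set" where
  "cstar_rep H \<rho> G = cstar_generated H (\<rho> ` G)"


section \<open>The Hilbert space of square-integrable functions\<close>

definition L2_fun :: "'a measure \<Rightarrow> ('a \<Rightarrow> complex) set" where
  "L2_fun M = {f. f \<in> borel_measurable M \<and> integrable M (\<lambda>x. (cmod (f x))\<^sup>2)}"

definition L2_class :: "'a measure \<Rightarrow> ('a \<Rightarrow> complex) \<Rightarrow> ('a \<Rightarrow> complex) set" where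
  "L2_class M f = {g \<in> L2_fun M. AE x in M. f x = g x}"

definition L2_rep :: "('a \<Rightarrow> complex) set \<Rightarrow> 'a \<Rightarrow> complex" where
  "L2_rep u = (SOME f. f \<in> u)"

definition L2 :: "'a measure \<Rightarrow> ('a \<Rightarrow> complex) set cinner_space" where
  "L2 M = \<lparr>hcarrier = L2_class M ` L2_fun M,
     hadd = (\<lambda>u v. L2_class M (\<lambda>x. L2_rep u x + L2_rep v x)),
     hscale = (\<lambda>c u. L2_class M (\<lambda>x. c * L2_rep u x)),
     hinner = (\<lambda>u v. \<integral>x. L2_rep u x * cnj (L2_rep v x) \<partial>M)\<rparr>"

lemma L2_class_eqI:
  assumes "AE x in M. f x = g x"
  shows "L2_class M f = L2_class M g"
  using assms unfolding L2_class_def by (auto elim: eventually_elim2)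

lemma L2_rep_class:
  assumes "f \<in> L2_fun M"
  shows "L2_rep (L2_class M f) \<in> L2_fun M" "AE x in M. L2_rep (L2_class M f) x = f x"
proof -
  have "f \<in> L2_class M f" using assms by (simp add: L2_class_def)
  then have *: "L2_rep (L2_class M f) \<in> L2_class M f" unfolding L2_rep_def by (rule someI[of "\<lambda>h. h \<in> L2_class M f"])
  then show "L2_rep (L2_class M f) \<in> L2_fun M" by (simp add: L2_class_def)
  from * show "AE x in M. L2_rep (L2_class M f) x = f x" by (auto simp: L2_class_def)
qed

lemma L2_add_class:
  assumes "f \<in> L2_fun M" "g \<in> L2_fun M"
  shows "hadd (L2 M) (L2_class M f) (L2_class M g) = L2_class M (\<lambda>x. f x + g x)"
  unfolding L2_def cinner_space.simps
  by (rule L2_class_eqI)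
    (use L2_rep_class(2)[OF assms(1)] L2_rep_class(2)[OF assms(2)] in eventually_elim, simp)

lemma L2_scale_class:
  assumes "f \<in> L2_fun M"
  shows "hscale (L2 M) c (L2_class M f) = L2_class M (\<lambda>x. c * f x)"
  unfolding L2_def cinner_space.simps
  by (rule L2_class_eqI) (use L2_rep_class(2)[OF assms] in eventually_elim, simp)

lemma L2_inner_class:
  assumes "f \<in> L2_fun M" "g \<in> L2_fun M"
  shows "hinner (L2 M) (L2_class M f) (L2_class M g) = (\<integral>x. f x * cnj (g x) \<partial>M)"
  unfolding L2_def cinner_space.simps
proof (rule integral_cong_AE)
  have [measurable]: "f \<in> borel_measurable M" "g \<in> borel_measurable M"
    "L2_rep (L2_class M f) \<in> borel_measurable M" "L2_rep (L2_class M g) \<in> borel_measurable M"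
    using assms L2_rep_class(1)[OF assms(1)] L2_rep_class(1)[OF assms(2)]
    by (auto simp: L2_fun_def)
  show "(\<lambda>x. L2_rep (L2_class M f) x * cnj (L2_rep (L2_class M g) x)) \<in> borel_measurable M"
    by (intro borel_measurable_times borel_measurable_continuous_on[where f=cnj]) (auto intro: continuous_intros)
  show "(\<lambda>x. f x * cnj (g x)) \<in> borel_measurable M"
    by (intro borel_measurable_times borel_measurable_continuous_on[where f=cnj]) (auto intro: continuous_intros)
  show "AE x in M. L2_rep (L2_class M f) x * cnj (L2_rep (L2_class M g) x) = f x * cnj (g x)"
    using L2_rep_class(2)[OF assms(1)] L2_rep_class(2)[OF assms(2)] by eventually_elim simp
qed


section \<open>Homeomorphisms and topological full groups\<close>

definition homeo_group :: "('a::topological_space \<Rightarrow> 'a) monoid" where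
  "homeo_group = \<lparr>carrier = {f. \<exists>g. homeomorphism UNIV UNIV f g}, mult = (\<circ>), one = id\<rparr>"

lemma group_homeo_group: "group homeo_group"
proof (rule groupI)
  fix f g h :: "'a::topological_space \<Rightarrow> 'a"
  assume "f \<in> carrier homeo_group" "g \<in> carrier homeo_group"
  then show "f \<otimes>\<^bsub>homeo_group\<^esub> g \<in> carrier homeo_group"
    unfolding homeo_group_def using homeomorphism_compose by fastforce
next
  fix f :: "'a::topological_space \<Rightarrow> 'a"
  assume "f \<in> carrier homeo_group"
  then obtain g where g: "homeomorphism UNIV UNIV f g" by (auto simp: homeo_group_def)
  then have "homeomorphism UNIV UNIV g f" "g \<circ> f = id"
    by (auto simp: homeomorphism_symD homeomorphism_def)
  then show "\<exists>g\<in>carrier homeo_group. g \<otimes>\<^bsub>homeo_group\<^esub> f = \<one>\<^bsub>homeo_group\<^esub>"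
    by (auto simp: homeo_group_def)
next
  have "homeomorphism UNIV UNIV id (id :: 'a::topological_space \<Rightarrow> 'a)"
    by (simp add: homeomorphism_def)
  then show "\<one>\<^bsub>homeo_group\<^esub> \<in> carrier (homeo_group :: ('a \<Rightarrow> 'a) monoid)"
    by (auto simp: homeo_group_def)
qed (auto simp: homeo_group_def comp_assoc)

lemma inv_homeo_group:
  assumes "homeomorphism UNIV UNIV f g"
  shows "inv\<^bsub>homeo_group\<^esub> f = g"
proof (rule group.inv_equality[OF group_homeo_group])
  show "g \<otimes>\<^bsub>homeo_group\<^esub> f = \<one>\<^bsub>homeo_group\<^esub>"
    using assms by (auto simp: homeo_group_def homeomorphism_def)
  show "f \<in> carrier homeo_group" "g \<in> carrier homeo_group"
    using assms homeomorphism_symD[OF assms] by (auto simp: homeo_group_def)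
qed

definition minimal_homeo :: "('a::topological_space \<Rightarrow> 'a) \<Rightarrow> bool" where
  "minimal_homeo T \<longleftrightarrow> T \<in> carrier homeo_group \<and>
     (\<forall>C. closed C \<and> T ` C = C \<longrightarrow> C = {} \<or> C = UNIV)"

text \<open>The full group is a subset of the homeomorphism group; inverses, integer powers and
  commutators are those of the latter.\<close>

definition topological_full_group :: "('a::topological_space \<Rightarrow> 'a) \<Rightarrow> ('a \<Rightarrow> 'a) set" where
  "topological_full_group T = {\<gamma> \<in> carrier homeo_group.
     \<exists>P. finite P \<and> partition_on UNIV P \<and>
       (\<forall>A\<in>P. open A \<and> closed A \<and> (\<exists>k::int. \<forall>x\<in>A. \<gamma> x = (T [^]\<^bsub>homeo_group\<^esub> k) x))}"

definition koopman ::
  "'a measure \<Rightarrow> ('a::topological_space \<Rightarrow> 'a) \<Rightarrow> ('a \<Rightarrow> complex) set \<Rightarrow> ('a \<Rightarrow> complex) set" where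
  "koopman M g = (\<lambda>u\<in>hcarrier (L2 M). L2_class M (L2_rep u \<circ> inv\<^bsub>homeo_group\<^esub> g))"

end

theory Submission
  imports Defs
begin

text \<open>Let \<open>A\<close> be a \<open>C\<^sup>*\<close>-algebra that contains the Koopman operators of the commutator subgroup.  It has
  to be shown that \<open>A\<close> contains the Koopman operator of every element of the full group.

  Call \<open>g\<close> displaceable if some \<open>T\<^sup>m\<close> and its square move the support of \<open>g\<close> to two further sets such
  that all three are pairwise disjoint.  For such a \<open>g\<close>, with Koopman operator \<open>u\<close>, the commutators
  \<open>e = [g, T\<^sup>2\<^sup>m]\<close> and \<open>d = [g\<^sup>n, T\<^sup>m]\<close> are products of \<open>g\<close> resp. \<open>g\<^sup>n\<close> with elements supported on the
  two other sets.  Operators \<open>v - 1\<close> and \<open>w - 1\<close> coming from elements with disjoint supports have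
  product zero, and hence the operators \<open>E\<close>, \<open>D\<close> of the commutators satisfy
  \<open>(E - 1) (D - 1) = (u - 1) (u\<^sup>n - 1)\<close> (lemma \<open>displaced_commutator_identity\<close>).  Thus
  \<open>u\<^sup>n\<^sup>+\<^sup>1 - u\<^sup>n - u\<close> lies in \<open>A\<close>, so modulo \<open>A\<close> the powers of \<open>u\<close> behave additively: \<open>u\<^sup>n\<close> is congruent
  to \<open>n u\<close> (lemma \<open>power_defect_in_A\<close>).  But \<open>u\<^sup>n\<close> is unitary, whence \<open>u\<close> has distance at most \<open>1 / n\<close>
  from \<open>A\<close> for every \<open>n\<close>, and \<open>u\<close> lies in \<open>A\<close> because \<open>A\<close> is closed (lemma \<open>koopman_displaceable\<close>).

  It remains to see that displaceable elements generate the full group (lemma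
  \<open>full_group_displaceable_generated\<close>).  Multiplying by a power of \<open>T\<close>, one may assume that \<open>\<gamma>\<close> only
  moves points forward along their orbits.  If \<open>V\<close> is a small clopen set disjoint from its image, then
  composing \<open>\<gamma>\<close> with the involution that exchanges \<open>V\<close> and \<open>\<gamma> V\<close> yields an element that fixes \<open>V\<close>
  pointwise, and this involution is displaceable.  Removing finitely many such sets in this way leaves
  an element supported on a prescribed small set \<open>W\<close>, which is again displaceable.  The difficulty is
  that the exponents grow in the process while the smallness of the sets \<open>V\<close> must be fixed in advance;
  it is overcome by taking \<open>W\<close> so thick that no jump can cross it (lemma \<open>small_support_generated\<close>).\<close>

section \<open>The group of homeomorphisms\<close>

abbreviation hinv :: "('a::topological_space \<Rightarrow> 'a) \<Rightarrow> 'a \<Rightarrow> 'a" where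
  "hinv g \<equiv> inv\<^bsub>homeo_group\<^esub> g"

lemma mult_homeo_group [simp]: "f \<otimes>\<^bsub>homeo_group\<^esub> g = f \<circ> g"
  by (simp add: homeo_group_def)

lemma one_homeo_group [simp]: "\<one>\<^bsub>homeo_group\<^esub> = id"
  by (simp add: homeo_group_def)

lemma homeo_groupD:
  assumes "g \<in> carrier homeo_group"
  shows "hinv g (g x) = x" "g (hinv g x) = x"
    "bij g" "continuous_on UNIV g" "continuous_on UNIV (hinv g)"
proof -
  obtain h where h: "homeomorphism UNIV UNIV g h"
    using assms by (auto simp: homeo_group_def)
  have *: "hinv g = h" by (rule inv_homeo_group[OF h])
  from h show "hinv g (g x) = x" "g (hinv g x) = x"
    "continuous_on UNIV g" "continuous_on UNIV (hinv g)"
    unfolding * by (auto simp: homeomorphism_def)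
  show "bij g"
    using h by (intro o_bij[of h]) (auto simp: homeomorphism_def)
qed

lemma hinv_eqI:
  assumes "g \<in> carrier homeo_group" "\<And>x. g (h x) = x"
  shows "hinv g = h"
  using homeo_groupD(1)[OF assms(1)] assms(2) by (metis ext)

lemma open_homeo_group:
  assumes "g \<in> carrier homeo_group" "open S"
  shows "open (g -` S)" "open (g ` S)"
proof -
  show "open (g -` S)"
    using homeo_groupD(4)[OF assms(1)] assms(2) by (simp add: continuous_on_open_vimage)
  have "g ` S = hinv g -` S"
    using homeo_groupD(1,2)[OF assms(1)] by (auto simp: image_iff) metis
  then show "open (g ` S)"
    using homeo_groupD(5)[OF assms(1)] assms(2) by (simp add: continuous_on_open_vimage)
qed

lemma closed_homeo_group:
  assumes "g \<in> carrier homeo_group" "closed S"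
  shows "closed (g -` S)" "closed (g ` S)"
proof -
  show "closed (g -` S)"
    using homeo_groupD(4)[OF assms(1)] assms(2) by (simp add: continuous_on_closed_vimage)
  have "- (g ` S) = g ` (- S)"
    using homeo_groupD(3)[OF assms(1)] by (simp add: bij_image_Compl_eq)
  then show "closed (g ` S)"
    using open_homeo_group(2)[OF assms(1), of "- S"] assms(2) by (simp add: closed_def)
qed

section \<open>Topological full groups of minimal systems\<close>

text \<open>The Cantor set enters through three of its properties: it is compact and infinite, and clopen
  sets separate its points.\<close>

locale cantor_minimal_system =
  fixes T :: "'a::topological_space \<Rightarrow> 'a"
  assumes minimal: "minimal_homeo T"
    and compact_UNIV: "compact (UNIV :: 'a set)"
    and clopen_separation: "x \<noteq> y \<Longrightarrow> \<exists>C :: 'a set. open C \<and> closed C \<and> x \<in> C \<and> y \<notin> C"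
    and infinite_UNIV: "infinite (UNIV :: 'a set)"
begin

abbreviation full :: "('a \<Rightarrow> 'a) set" where
  "full \<equiv> topological_full_group T"

definition tpow :: "int \<Rightarrow> 'a \<Rightarrow> 'a" where
  "tpow k = T [^]\<^bsub>homeo_group\<^esub> k"

lemma T_in_carrier: "T \<in> carrier homeo_group"
  using minimal by (simp add: minimal_homeo_def)

lemma tpow_in_carrier: "tpow k \<in> carrier homeo_group"
  unfolding tpow_def by (rule group.int_pow_closed[OF group_homeo_group T_in_carrier])

lemma tpow_0 [simp]: "tpow 0 x = x"
  by (simp add: tpow_def)

lemma tpow_1: "tpow 1 x = T x"
  by (simp add: tpow_def group.int_pow_1[OF group_homeo_group T_in_carrier])

lemma tpow_tpow [simp]: "tpow a (tpow b x) = tpow (a + b) x"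
  using group.int_pow_mult[OF group_homeo_group T_in_carrier, of a b]
  by (simp add: tpow_def)

lemma tpow_eq_iff: "tpow k x = y \<longleftrightarrow> x = tpow (- k) y"
  by auto

lemma open_tpow: "open S \<Longrightarrow> open (tpow k -` S)"
  and closed_tpow: "closed S \<Longrightarrow> closed (tpow k -` S)"
  using open_homeo_group closed_homeo_group tpow_in_carrier by blast+

lemma closed_singleton: "closed {x :: 'a}"
proof -
  have "\<exists>C. open C \<and> y \<in> C \<and> C \<subseteq> - {x}" if "y \<in> - {x}" for y
    using clopen_separation[of y x] that by auto
  then have "open (- {x})" by (subst open_subopen) blast
  then show ?thesis by (simp add: closed_def)
qed

text \<open>A periodic orbit would be a finite, hence closed, invariant set; by minimality it would be the
  whole space, which is infinite.\<close>

lemma aperiodic: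
  assumes "tpow k x = x"
  shows "k = 0"
proof (rule ccontr)
  assume "k \<noteq> 0"
  define p where "p = \<bar>k\<bar>"
  have p: "p > 0" "tpow p x = x"
    using \<open>k \<noteq> 0\<close> assms tpow_eq_iff[of k x x] by (auto simp: p_def abs_if)
  have mult: "tpow (p * int n) x = x" for n
  proof (induction n)
    case (Suc n)
    then have "tpow (p * int n) (tpow p x) = x" using p by simp
    then show ?case by (simp add: algebra_simps)
  qed simp
  have mult': "tpow (p * j) x = x" for j
  proof (cases "j \<ge> 0")
    case True then show ?thesis using mult[of "nat j"] by simp
  next
    case False
    then have "tpow (- (p * j)) x = x" using mult[of "nat (- j)"] by simp
    then show ?thesis by (metis tpow_eq_iff)
  qed
  define C where "C = (\<lambda>j. tpow j x) ` {0..<p}"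
  have C: "tpow j x \<in> C" for j
  proof -
    have "tpow j x = tpow (j mod p) (tpow (p * (j div p)) x)" by simp
    also have "\<dots> = tpow (j mod p) x" by (simp only: mult')
    finally show ?thesis using p by (auto simp: C_def)
  qed
  have "finite C" by (simp add: C_def)
  then have "closed C"
  proof (induction rule: finite_induct)
    case (insert y F)
    then show ?case using closed_Un[OF closed_singleton[of y], of F] by simp
  qed simp
  moreover have "T ` C = C"
  proof
    show "T ` C \<subseteq> C"
    proof safe
      fix y assume "y \<in> C"
      then obtain j where "y = tpow j x" unfolding C_def by blast
      then have "T y = tpow (1 + j) x" by (metis tpow_1 tpow_tpow)
      then show "T y \<in> C" using C by metis
    qed
    show "C \<subseteq> T ` C"
    proof
      fix y assume "y \<in> C"
      then obtain j where "y = tpow j x" unfolding C_def by blast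
      moreover have "T (tpow (j - 1) x) = tpow (1 + (j - 1)) x" by (metis tpow_1 tpow_tpow)
      ultimately have "y = T (tpow (j - 1) x)" by simp
      then show "y \<in> T ` C" using C by blast
    qed
  qed
  ultimately have "C = UNIV"
    using minimal C[of 0] by (auto simp: minimal_homeo_def)
  then show False using \<open>finite C\<close> infinite_UNIV by simp
qed

lemma tpow_inj_exp: "tpow k x = tpow l x \<longleftrightarrow> k = l"
proof
  assume "tpow k x = tpow l x"
  then have "tpow (- l) (tpow k x) = x" by (simp add: tpow_eq_iff)
  then show "k = l" using aperiodic[of "k - l" x] by simp
qed simp

lemma open_cover_finite:
  assumes "\<And>k. open (f k :: 'a set)" "(\<Union>k. f k) = UNIV"
  shows "\<exists>K. finite K \<and> (\<Union>k\<in>K. f k) = UNIV"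
proof (rule compactE_image[OF compact_UNIV, where f = f and C = UNIV])
  show "open (f k)" for k by (rule assms)
  show "UNIV \<subseteq> (\<Union>k. f k)" using assms(2) by simp
  fix K assume "finite K" "UNIV \<subseteq> (\<Union>k\<in>K. f k)"
  then show "\<exists>K. finite K \<and> (\<Union>k\<in>K. f k) = UNIV" by (metis top.extremum_uniqueI)
qed

text \<open>The full group can be recognised locally.  Since no power of \<open>T\<close> other than the identity has a
  fixed point, the exponent \<open>k\<close> at a point is unique; the level sets of the exponent are therefore
  disjoint open sets that cover the space, and compactness makes them a finite clopen partition.  The
  local form makes closure under composition, inversion and cutting and pasting immediate.\<close>

lemma full_groupI:
  assumes bij: "bij \<gamma>"
    and loc: "\<And>x. \<exists>k G. open G \<and> x \<in> G \<and> (\<forall>y\<in>G. \<gamma> y = tpow k y)"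
  shows "\<gamma> \<in> full"
proof -
  define \<Gamma> where "\<Gamma> k = {x. \<gamma> x = tpow k x}" for k
  have open_\<Gamma>: "open (\<Gamma> k)" for k
  proof (subst open_subopen, intro ballI)
    fix x assume x: "x \<in> \<Gamma> k"
    obtain l G where G: "open G" "x \<in> G" "\<forall>y\<in>G. \<gamma> y = tpow l y" using loc by blast
    then have "l = k" using x by (auto simp: \<Gamma>_def tpow_inj_exp)
    then show "\<exists>S. open S \<and> x \<in> S \<and> S \<subseteq> \<Gamma> k" using G by (auto simp: \<Gamma>_def)
  qed
  have disj: "\<Gamma> k \<inter> \<Gamma> l = {}" if "k \<noteq> l" for k l
    using that by (auto simp: \<Gamma>_def tpow_inj_exp)
  have power: "\<exists>k. \<gamma> x = tpow k x" for x using loc[of x] by blast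
  then have cover: "(\<Union>k. \<Gamma> k) = UNIV" by (auto simp: \<Gamma>_def)
  obtain K where K: "finite K" "(\<Union>k\<in>K. \<Gamma> k) = UNIV"
    using open_cover_finite[of \<Gamma>, OF _ cover] open_\<Gamma> by metis
  have closed_\<Gamma>: "closed (\<Gamma> k)" for k
  proof -
    have "- \<Gamma> k = (\<Union>l\<in>- {k}. \<Gamma> l)"
    proof (intro equalityI subsetI)
      fix y assume y: "y \<in> - \<Gamma> k"
      obtain l where "y \<in> \<Gamma> l" using cover by blast
      then show "y \<in> (\<Union>l\<in>- {k}. \<Gamma> l)" using y by (cases "l = k") auto
    qed (use disj in blast)
    then show ?thesis using open_\<Gamma> by (simp add: closed_def open_UN)
  qed
  define P where "P = \<Gamma> ` K - {{}}"
  have "finite P" using K by (simp add: P_def)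
  moreover have "partition_on UNIV P"
    unfolding partition_on_def
  proof (intro conjI)
    have "\<Union> P = \<Union> (\<Gamma> ` K)" by (auto simp: P_def)
    then show "\<Union> P = UNIV" using K by simp
    show "disjoint P"
    proof (rule disjointI)
      fix A B assume "A \<in> P" "B \<in> P" "A \<noteq> B"
      moreover from this obtain k l where "A = \<Gamma> k" "B = \<Gamma> l" by (auto simp: P_def)
      ultimately show "A \<inter> B = {}" using disj[of k l] by metis
    qed
    show "{} \<notin> P" by (simp add: P_def)
  qed
  moreover have "\<forall>A\<in>P. open A \<and> closed A \<and> (\<exists>k. \<forall>x\<in>A. \<gamma> x = tpow k x)"
    using open_\<Gamma> closed_\<Gamma> by (auto simp: P_def \<Gamma>_def)
  moreover have "\<gamma> \<in> carrier homeo_group"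
  proof -
    define h where "h = inv_into UNIV \<gamma>"
    have h: "h (\<gamma> x) = x" "\<gamma> (h x) = x" for x
      using bij by (auto simp: h_def bij_is_inj bij_is_surj surj_f_inv_f)
    have "continuous_on UNIV \<gamma>"
      unfolding continuous_on_open_vimage[OF open_UNIV]
    proof safe
      fix B :: "'a set" assume "open B"
      have "\<gamma> -` B = (\<Union>k. \<Gamma> k \<inter> tpow k -` B)"
      proof -
        have "\<gamma> x \<in> B \<longleftrightarrow> (\<exists>k. \<gamma> x = tpow k x \<and> tpow k x \<in> B)" for x using power by metis
        then show ?thesis unfolding \<Gamma>_def by blast
      qed
      then show "open (\<gamma> -` B \<inter> UNIV)"
        using open_\<Gamma> open_tpow[OF \<open>open B\<close>] by (simp add: open_UN open_Int)
    qed
    moreover have "continuous_on UNIV h"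
      unfolding continuous_on_open_vimage[OF open_UNIV]
    proof safe
      fix B :: "'a set" assume "open B"
      have "h -` B = (\<Union>k. tpow (- k) -` (\<Gamma> k \<inter> B))"
      proof (intro equalityI subsetI)
        fix y assume y: "y \<in> h -` B"
        obtain k where k: "h y \<in> \<Gamma> k" using cover by blast
        then have "y = tpow k (h y)" by (simp add: \<Gamma>_def h)
        then have "h y = tpow (- k) y" by (metis tpow_eq_iff)
        then show "y \<in> (\<Union>k. tpow (- k) -` (\<Gamma> k \<inter> B))" using k y by auto
      next
        fix y assume "y \<in> (\<Union>k. tpow (- k) -` (\<Gamma> k \<inter> B))"
        then obtain k where k: "tpow (- k) y \<in> \<Gamma> k" "tpow (- k) y \<in> B" by auto
        then have "\<gamma> (tpow (- k) y) = y" by (simp add: \<Gamma>_def)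
        then have "h y = tpow (- k) y" using h by metis
        then show "y \<in> h -` B" using k by simp
      qed
      then show "open (h -` B \<inter> UNIV)"
        using open_\<Gamma> open_tpow \<open>open B\<close> by (simp add: open_UN open_Int del: vimage_Int)
    qed
    ultimately have "homeomorphism UNIV UNIV \<gamma> h"
      using h surjI[of \<gamma> h] surjI[of h \<gamma>] by (simp add: homeomorphism_def)
    then show ?thesis by (auto simp: homeo_group_def)
  qed
  ultimately show ?thesis unfolding topological_full_group_def tpow_def by blast
qed

lemma full_group_carrier: "\<gamma> \<in> full \<Longrightarrow> \<gamma> \<in> carrier homeo_group"
  by (simp add: topological_full_group_def)

lemma full_group_finite:
  assumes "\<gamma> \<in> full"
  shows "\<exists>K. finite K \<and> (\<forall>x. \<exists>k\<in>K. \<exists>G. open G \<and> x \<in> G \<and> (\<forall>y\<in>G. \<gamma> y = tpow k y))"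
proof -
  obtain P where P: "finite P" "partition_on UNIV P"
    "\<And>A. A \<in> P \<Longrightarrow> open A \<and> (\<exists>k. \<forall>x\<in>A. \<gamma> x = tpow k x)"
    using assms unfolding topological_full_group_def tpow_def by blast
  from P(3) obtain k where k: "\<And>A x. A \<in> P \<Longrightarrow> x \<in> A \<Longrightarrow> \<gamma> x = tpow (k A) x" by metis
  show ?thesis
  proof (intro exI[of _ "k ` P"] conjI allI)
    show "finite (k ` P)" using P by simp
    fix x
    obtain A where "A \<in> P" "x \<in> A" using P(2) by (auto simp: partition_on_def)
    then show "\<exists>k\<in>k ` P. \<exists>G. open G \<and> x \<in> G \<and> (\<forall>y\<in>G. \<gamma> y = tpow k y)"
      using P(3)[of A] k by blast
  qed
qed

lemma full_group_local:
  assumes "\<gamma> \<in> full"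
  shows "\<exists>k G. open G \<and> x \<in> G \<and> (\<forall>y\<in>G. \<gamma> y = tpow k y)"
  using full_group_finite[OF assms] by metis

lemma open_level:
  assumes "\<gamma> \<in> full"
  shows "open {x. \<gamma> x = tpow k x}"
proof (subst open_subopen, intro ballI)
  fix x assume x: "x \<in> {x. \<gamma> x = tpow k x}"
  obtain l G where G: "open G" "x \<in> G" "\<forall>y\<in>G. \<gamma> y = tpow l y"
    using full_group_local[OF assms] by blast
  then have "l = k" using x by (auto simp: tpow_inj_exp)
  then show "\<exists>S. open S \<and> x \<in> S \<and> S \<subseteq> {x. \<gamma> x = tpow k x}" using G by auto
qed

lemma tpow_in_full: "tpow k \<in> full"
  using homeo_groupD(3)[OF tpow_in_carrier] by (intro full_groupI) auto

lemma full_comp: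
  assumes "f \<in> full" "g \<in> full"
  shows "f \<circ> g \<in> full"
proof (rule full_groupI)
  show "bij (f \<circ> g)"
    by (rule bij_comp[OF homeo_groupD(3) homeo_groupD(3)]) (use assms full_group_carrier in blast)+
  fix x
  obtain k G where G: "open G" "x \<in> G" "\<forall>y\<in>G. g y = tpow k y"
    using full_group_local[OF assms(2)] by blast
  obtain l Q where Q: "open Q" "g x \<in> Q" "\<forall>y\<in>Q. f y = tpow l y"
    using full_group_local[OF assms(1)] by blast
  show "\<exists>k G. open G \<and> x \<in> G \<and> (\<forall>y\<in>G. (f \<circ> g) y = tpow k y)"
    using G Q open_tpow
    by (intro exI[of _ "l + k"] exI[of _ "G \<inter> tpow k -` Q"]) auto
qed

lemma full_inv:
  assumes "g \<in> full"
  shows "hinv g \<in> full"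
proof (rule full_groupI)
  note g = full_group_carrier[OF assms]
  have "hinv g \<in> carrier homeo_group"
    by (rule group.inv_closed[OF group_homeo_group g])
  then show "bij (hinv g)" by (rule homeo_groupD)
  fix x
  obtain k G where G: "open G" "hinv g x \<in> G" "\<forall>y\<in>G. g y = tpow k y"
    using full_group_local[OF assms] by blast
  have "hinv g y = tpow (- k) y" if y: "y \<in> g ` G" for y
  proof -
    obtain z where z: "z \<in> G" "y = g z" using y by blast
    then have "hinv g y = z" using homeo_groupD(1)[OF g] by simp
    moreover have "tpow (- k) y = z" using z G(3) by simp
    ultimately show ?thesis by simp
  qed
  moreover have "x \<in> g ` G" using G(2) homeo_groupD(2)[OF g] by (metis imageI)
  ultimately show "\<exists>k G. open G \<and> x \<in> G \<and> (\<forall>y\<in>G. hinv g y = tpow k y)"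
    using open_homeo_group(2)[OF g G(1)] by blast
qed

lemma subgroup_full: "subgroup full homeo_group"
  using tpow_in_full[of 0]
  by (intro group.subgroupI[OF group_homeo_group])
     (auto simp: full_group_carrier full_inv full_comp)

section \<open>Generation by displaceable elements\<close>

text \<open>The condition says that the supports of \<open>g\<close> and of its conjugates by \<open>T\<^sup>m\<close> and \<open>T\<^sup>2\<^sup>m\<close> are
  pairwise disjoint: three disjoint copies of \<open>g\<close> are what the operator argument below consumes.\<close>

definition displaceable :: "('a \<Rightarrow> 'a) \<Rightarrow> bool" where
  "displaceable g \<longleftrightarrow> g \<in> full \<and>
     (\<exists>m. \<forall>x. g x \<noteq> x \<longrightarrow> g (tpow m x) = tpow m x \<and> g (tpow (2 * m) x) = tpow (2 * m) x)"

lemma displaceable_inv: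
  assumes "displaceable g"
  shows "displaceable (hinv g)"
proof -
  have g: "g \<in> full" "g \<in> carrier homeo_group"
    using assms full_group_carrier by (auto simp: displaceable_def)
  have "hinv g x = x \<longleftrightarrow> g x = x" for x
    using homeo_groupD(1,2)[OF g(2)] by metis
  then show ?thesis using assms full_inv[OF g(1)] by (simp add: displaceable_def)
qed

text \<open>By aperiodicity \<open>x\<close> and \<open>T\<^sup>j x\<close> are separated by a clopen set \<open>C\<close>, and \<open>C - T\<^sup>-\<^sup>jC\<close> is a
  neighbourhood of \<open>x\<close> disjoint from its image under \<open>T\<^sup>j\<close>; intersect these sets over \<open>j\<close>.\<close>

lemma small_neighbourhood:
  "\<exists>V. open V \<and> closed V \<and> x \<in> V \<and>
     (\<forall>y\<in>V. \<forall>j. 0 < j \<longrightarrow> j \<le> int n \<longrightarrow> tpow j y \<notin> V)"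
proof -
  have "\<exists>V. open V \<and> closed V \<and> x \<in> V \<and> (\<forall>y\<in>V. \<forall>j\<in>{1..int n}. tpow j y \<notin> V)"
  proof (induction n)
    case 0
    show ?case by (intro exI[of _ UNIV]) auto
  next
    case (Suc n)
    then obtain V where V: "open V" "closed V" "x \<in> V" "\<forall>y\<in>V. \<forall>j\<in>{1..int n}. tpow j y \<notin> V"
      by blast
    have "tpow (int (Suc n)) x \<noteq> x" using aperiodic by fastforce
    then obtain C where C: "open C" "closed C" "x \<in> C" "tpow (int (Suc n)) x \<notin> C"
      using clopen_separation by metis
    let ?V = "V \<inter> C - tpow (int (Suc n)) -` C"
    have "tpow j y \<notin> ?V" if "y \<in> ?V" "j \<in> {1..int (Suc n)}" for y j
      using that V(4) by (cases "j = int (Suc n)") auto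
    moreover have "open ?V" "closed ?V" "x \<in> ?V"
      using V C open_tpow closed_tpow by (auto intro!: open_Diff closed_Diff open_Int closed_Int)
    ultimately show ?case by (intro exI[of _ ?V] conjI ballI) assumption+
  qed
  then obtain V where "open V" "closed V" "x \<in> V" "\<forall>y\<in>V. \<forall>j\<in>{1..int n}. tpow j y \<notin> V"
    by blast
  then show ?thesis by (intro exI[of _ V]) simp
qed

text \<open>The two-sided orbit of \<open>U\<close> is the whole space by minimality, and by compactness finitely many
  translates, with exponents between \<open>-B\<close> and \<open>B\<close>, suffice.  Shifting them all by \<open>B\<close> makes the
  hitting times nonnegative.\<close>

lemma bounded_hitting_time:
  assumes "open U" "U \<noteq> {}"
  shows "\<exists>N. \<forall>x. \<exists>m\<le>N. tpow (int m) x \<in> U"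
proof -
  define C where "C = - (\<Union>j. tpow j -` U)"
  have "closed C" unfolding C_def using open_tpow[OF assms(1)] by (auto simp: closed_def)
  moreover have "T ` C = C"
  proof
    have sub: "tpow k ` C \<subseteq> C" for k by (auto simp: C_def)
    show "T ` C \<subseteq> C" using sub[of 1] by (metis tpow_1 image_cong)
    show "C \<subseteq> T ` C"
    proof
      fix y assume "y \<in> C"
      then have "tpow (- 1) y \<in> C" using sub by blast
      moreover have "T (tpow (- 1) y) = y" by (metis tpow_1 tpow_tpow tpow_0 add.right_inverse)
      ultimately show "y \<in> T ` C" by (metis imageI)
    qed
  qed
  moreover have "C \<noteq> UNIV"
  proof -
    obtain u where "u \<in> U" using assms(2) by blast
    then have "u \<in> tpow 0 -` U" by simp
    then have "u \<notin> C" unfolding C_def by blast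
    then show ?thesis by blast
  qed
  ultimately have "C = {}" using minimal by (auto simp: minimal_homeo_def)
  then have "(\<Union>j. tpow j -` U) = UNIV" unfolding C_def by blast
  then obtain J where J: "finite J" "(\<Union>j\<in>J. tpow j -` U) = UNIV"
    using open_cover_finite[of "\<lambda>j. tpow j -` U"] open_tpow[OF assms(1)] by metis
  define B where "B = Max ((\<lambda>j. nat \<bar>j\<bar>) ` insert 0 J)"
  have B: "nat \<bar>j\<bar> \<le> B" if "j \<in> J" for j
    unfolding B_def using J(1) that by (intro Max_ge) auto
  show ?thesis
  proof (rule exI[of _ "2 * B"], rule allI)
    fix x
    obtain j where j: "j \<in> J" "tpow j (tpow (int B) x) \<in> U" using J(2) by blast
    then have "tpow (int (nat (j + int B))) x \<in> U" "nat (j + int B) \<le> 2 * B"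
      using B[OF j(1)] by auto
    then show "\<exists>m\<le>2 * B. tpow (int m) x \<in> U" by blast
  qed
qed

text \<open>If the support lies in the first \<open>L + 1\<close> levels of a tower over \<open>V\<close> of height \<open>3 (L + 1)\<close>,
  then shifting by \<open>L + 1\<close> and by \<open>2 (L + 1)\<close> moves it to disjoint groups of levels.\<close>

lemma displaceableI:
  assumes "g \<in> full"
    and supp: "\<And>x. g x \<noteq> x \<Longrightarrow> \<exists>j y. 0 \<le> j \<and> j \<le> L \<and> y \<in> V \<and> x = tpow j y"
    and V: "\<And>y j. y \<in> V \<Longrightarrow> 0 < j \<Longrightarrow> j \<le> 3 * L + 2 \<Longrightarrow> tpow j y \<notin> V"
  shows "displaceable g"
proof -
  have *: "g (tpow k x) = tpow k x" if x: "g x \<noteq> x" and k: "L < k" "k \<le> 2 * L + 2" for x k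
  proof (rule ccontr)
    assume "g (tpow k x) \<noteq> tpow k x"
    from supp[OF this] supp[OF x] obtain j y j' y' where
      j: "0 \<le> j" "j \<le> L" "y \<in> V" "x = tpow j y" "0 \<le> j'" "j' \<le> L" "y' \<in> V" "tpow k x = tpow j' y'"
      by auto
    then have "tpow (k + j - j') y = y'" by (metis tpow_tpow tpow_eq_iff add.commute uminus_add_conv_diff)
    moreover have "0 < k + j - j'" "k + j - j' \<le> 3 * L + 2" using j k by auto
    ultimately show False using V j by blast
  qed
  have "g (tpow (L + 1) x) = tpow (L + 1) x \<and> g (tpow (2 * (L + 1)) x) = tpow (2 * (L + 1)) x"
    if "g x \<noteq> x" for x
  proof -
    have "0 \<le> L" using supp[OF that] by auto
    then show ?thesis using *[OF that] by auto
  qed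
  then show ?thesis unfolding displaceable_def using assms(1) by blast
qed

abbreviation displaceable_generated :: "('a \<Rightarrow> 'a) set" where
  "displaceable_generated \<equiv> generate homeo_group {g. displaceable g}"

text \<open>The element \<open>\<delta>\<close> exchanges \<open>V\<close> and \<open>\<gamma> V\<close> by \<open>\<gamma>\<close> and its inverse.  It is used to peel off
  the part of \<open>\<gamma>\<close> that starts in \<open>V\<close>: the product \<open>\<delta> \<circ> \<gamma>\<close> fixes \<open>V\<close> pointwise.\<close>

lemma swap_in_full:
  assumes \<gamma>: "\<gamma> \<in> full" and V: "open V" "closed V" and disj: "\<And>x. x \<in> V \<Longrightarrow> \<gamma> x \<notin> V"
  obtains \<delta> where "\<delta> \<in> full" "\<And>x. \<delta> (\<delta> x) = x" "\<And>x. x \<in> V \<Longrightarrow> \<delta> x = \<gamma> x"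
    "\<And>x. x \<in> V \<Longrightarrow> \<delta> (\<gamma> x) = x" "\<And>x. x \<notin> V \<Longrightarrow> x \<notin> \<gamma> ` V \<Longrightarrow> \<delta> x = x"
proof -
  define h where "h = hinv \<gamma>"
  note \<gamma>c = full_group_carrier[OF \<gamma>]
  have h: "h (\<gamma> x) = x" "\<gamma> (h x) = x" for x
    unfolding h_def using homeo_groupD(1,2)[OF \<gamma>c] by auto
  have hf: "h \<in> full" unfolding h_def by (rule full_inv[OF \<gamma>])
  define \<delta> where "\<delta> x = (if x \<in> V then \<gamma> x else if x \<in> \<gamma> ` V then h x else x)" for x
  have 1: "\<delta> x = \<gamma> x" "\<delta> (\<gamma> x) = x" if "x \<in> V" for x
    using that disj h by (auto simp: \<delta>_def)
  have 2: "\<delta> x = x" if "x \<notin> V" "x \<notin> \<gamma> ` V" for x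
    using that by (simp add: \<delta>_def)
  have inv: "\<delta> (\<delta> x) = x" for x
  proof (cases "x \<in> V \<or> x \<in> \<gamma> ` V")
    case True then show ?thesis using 1 by (elim disjE imageE) (simp_all)
  qed (simp add: 2)
  have "\<delta> \<in> full"
  proof (rule full_groupI)
    show "bij \<delta>" using inv by (intro o_bij[of \<delta>]) auto
    fix x
    note * = open_homeo_group(2)[OF \<gamma>c V(1)] closed_homeo_group(2)[OF \<gamma>c V(2)]
    consider "x \<in> V" | "x \<in> \<gamma> ` V" | "x \<notin> V" "x \<notin> \<gamma> ` V" by blast
    then show "\<exists>k G. open G \<and> x \<in> G \<and> (\<forall>y\<in>G. \<delta> y = tpow k y)"
    proof cases
      case 1
      obtain k G where "open G" "x \<in> G" "\<forall>y\<in>G. \<gamma> y = tpow k y"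
        using full_group_local[OF \<gamma>] by blast
      then show ?thesis using 1 V
        by (intro exI[of _ k] exI[of _ "G \<inter> V"]) (auto simp: \<delta>_def)
    next
      case 2
      obtain k G where "open G" "x \<in> G" "\<forall>y\<in>G. h y = tpow k y"
        using full_group_local[OF hf] by blast
      then show ?thesis using 2 * disj
        by (intro exI[of _ k] exI[of _ "G \<inter> \<gamma> ` V"]) (auto simp: \<delta>_def)
    next
      case 3
      then show ?thesis using * V
        by (intro exI[of _ 0] exI[of _ "- V - \<gamma> ` V"]) (auto simp: \<delta>_def)
    qed
  qed
  then show thesis using that 1 2 inv by blast
qed

text \<open>The core of the fragmentation.  Here \<open>\<gamma>\<close> only moves points forward, by \<open>n x\<close> steps at \<open>x\<close>, and
  outside the small set \<open>W\<close>, the union of \<open>T\<^sup>j U\<close> for \<open>j \<le> K\<close>, it is supported on finitely many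
  small sets.  These are removed one after the other by composing with a swap; what remains at the end
  is supported on \<open>W\<close> and is itself displaceable.

  The sets in \<open>\<V>\<close> have to be small with respect to a bound on \<open>n\<close>, and this bound must survive the
  induction although a single swap can double an exponent.  The assumption \<open>barrier\<close> provides it: \<open>\<gamma>\<close>
  never jumps beyond the first \<open>K\<close> points that follow the next visit of the orbit to \<open>U\<close>, and these
  points lie in \<open>W\<close>.  Replacing \<open>\<gamma>\<close> by \<open>\<delta> \<circ> \<gamma>\<close> means that a point
  that would land in the removed set moves on by \<open>\<gamma>\<close> once more.  As the removed set is disjoint from
  \<open>W\<close>, the point has not passed the next visit to \<open>U\<close> at its intermediate stop, and so the second jump
  cannot go beyond \<open>W\<close> either.  Together with the bound \<open>N\<close> for the hitting times of \<open>U\<close> this gives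
  \<open>n x \<le> N + K\<close> throughout.\<close>

lemma small_support_generated:
  assumes V: "\<And>y j. y \<in> U \<Longrightarrow> 0 < j \<Longrightarrow> j \<le> 3 * int K + 3 \<Longrightarrow> tpow j y \<notin> U"
    and W: "W = (\<Union>j\<in>{0..int K}. tpow (- j) -` U)" "open W" "closed W"
    and fam: "finite \<V>" "\<And>V. V \<in> \<V> \<Longrightarrow> open V \<and> closed V"
    and small: "\<And>V y j. V \<in> \<V> \<Longrightarrow> y \<in> V \<Longrightarrow> 0 < j \<Longrightarrow> j \<le> 3 * int (N + K) + 3 \<Longrightarrow> tpow j y \<notin> V"
    and N: "\<And>x. \<exists>m\<le>N. tpow (int m) x \<in> U"
    and \<gamma>: "\<gamma> \<in> full" "\<And>x. \<gamma> x = tpow (int (n x)) x"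
    and barrier: "\<And>x m. tpow (int m) x \<in> U \<Longrightarrow> n x \<le> m + K"
    and supp: "\<And>x. \<gamma> x \<noteq> x \<Longrightarrow> x \<in> W \<union> \<Union>\<V>"
  shows "\<gamma> \<in> displaceable_generated"
  using fam small \<gamma> barrier supp
proof (induction \<V> arbitrary: \<gamma> n rule: finite_induct)
  case empty
  have "displaceable \<gamma>"
  proof (rule displaceableI)
    show "\<gamma> \<in> full" by fact
    fix x assume "\<gamma> x \<noteq> x"
    then have "x \<in> W" using empty by blast
    then obtain j where "j \<in> {0..int K}" "tpow (- j) x \<in> U" unfolding W(1) by blast
    then show "\<exists>j y. 0 \<le> j \<and> j \<le> int K \<and> y \<in> U \<and> x = tpow j y"
      by (intro exI[of _ j] exI[of _ "tpow (- j) x"]) auto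
  qed (use V in auto)
  then show ?case by (auto intro: generate.incl)
next
  case (insert V \<V>)
  have bound: "n x \<le> N + K" for x using N[of x] insert.prems(5) by fastforce
  have W_I: "tpow j u \<in> W" if "u \<in> U" "0 \<le> j" "j \<le> int K" for u j
    unfolding W(1) using that by (intro UN_I[of j]) auto
  have clopen_V: "open V" "closed V" using insert.prems(1) by auto
  have smallV: "tpow j y \<notin> V" if "y \<in> V" "0 < j" "j \<le> 3 * int (N + K) + 3" for y j
    using insert.prems(2)[of V y j] that by blast
  (* Smallness of V and the bound on n force a point of V whose image is in V to be fixed, so
     removing such points from V0 loses nothing and makes V' disjoint from its image. *)
  define V0 where "V0 = V - W"
  define V' where "V' = V0 - \<gamma> -` V0"
  note \<gamma>c = full_group_carrier[OF insert.prems(3)]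
  have inj: "\<gamma> x = \<gamma> y \<Longrightarrow> x = y" for x y using homeo_groupD(1)[OF \<gamma>c] by metis
  have V0: "open V0" "closed V0" using clopen_V W by (auto simp: V0_def open_Diff closed_Diff)
  then have V': "open V'" "closed V'"
    unfolding V'_def using open_homeo_group(1)[OF \<gamma>c] closed_homeo_group(1)[OF \<gamma>c]
    by (auto intro: open_Diff closed_Diff)
  have disj: "\<gamma> x \<notin> V'" if "x \<in> V'" for x using that by (auto simp: V'_def)
  obtain \<delta> where \<delta>: "\<delta> \<in> full" "\<And>x. \<delta> (\<delta> x) = x" "\<And>x. x \<in> V' \<Longrightarrow> \<delta> x = \<gamma> x"
    "\<And>x. x \<in> V' \<Longrightarrow> \<delta> (\<gamma> x) = x" "\<And>x. x \<notin> V' \<Longrightarrow> x \<notin> \<gamma> ` V' \<Longrightarrow> \<delta> x = x"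
    using swap_in_full[OF insert.prems(3) V' disj] by blast
  have V'_sub: "x \<in> V" "x \<notin> W" if "x \<in> V'" for x using that by (auto simp: V'_def V0_def)
  have "displaceable \<delta>"
  proof (rule displaceableI)
    show "\<delta> \<in> full" by fact
    fix x assume "\<delta> x \<noteq> x"
    then consider "x \<in> V'" | y where "y \<in> V'" "x = \<gamma> y" using \<delta>(5) by blast
    then show "\<exists>j y. 0 \<le> j \<and> j \<le> int (N + K) \<and> y \<in> V \<and> x = tpow j y"
    proof cases
      case 1
      then show ?thesis using V'_sub by (intro exI[of _ 0] exI[of _ x]) auto
    next
      case 2
      then show ?thesis using V'_sub bound[of y] insert.prems(4)[of y]
        by (intro exI[of _ "int (n y)"] exI[of _ y]) auto
    qed
  qed (use smallV in auto)
  then have \<delta>_gen: "\<delta> \<in> displaceable_generated" by (auto intro: generate.incl)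
  define n' where "n' x = (if x \<in> V' then 0 else if \<gamma> x \<in> V' then n x + n (\<gamma> x) else n x)" for x
  have "\<delta> \<circ> \<gamma> \<in> displaceable_generated"
  proof (rule insert.IH)
    show "open A \<and> closed A" if "A \<in> \<V>" for A using insert.prems(1) that by blast
    show "tpow j y \<notin> A" if "A \<in> \<V>" "y \<in> A" "0 < j" "j \<le> 3 * int (N + K) + 3" for A y j
      using insert.prems(2) that by blast
    show "\<delta> \<circ> \<gamma> \<in> full" using \<delta>(1) insert.prems(3) by (rule full_comp)
    show "(\<delta> \<circ> \<gamma>) x = tpow (int (n' x)) x" for x
    proof -
      consider "x \<in> V'" | "x \<notin> V'" "\<gamma> x \<in> V'" | "x \<notin> V'" "\<gamma> x \<notin> V'" by blast
      then show ?thesis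
      proof cases
        case 1
        then show ?thesis using \<delta>(4) by (simp add: n'_def)
      next
        case 2
        then have "(\<delta> \<circ> \<gamma>) x = \<gamma> (\<gamma> x)" using \<delta>(3) by simp
        also have "\<dots> = tpow (int (n (\<gamma> x))) (tpow (int (n x)) x)"
          using insert.prems(4)[of x] insert.prems(4)[of "\<gamma> x"] by simp
        finally show ?thesis using 2 by (simp add: n'_def add.commute)
      next
        case 3
        then have "\<gamma> x \<notin> \<gamma> ` V'" using inj by blast
        then have "(\<delta> \<circ> \<gamma>) x = \<gamma> x" using \<delta>(5) 3 by simp
        then show ?thesis using 3 insert.prems(4)[of x] by (simp add: n'_def)
      qed
    qed
    show "n' x \<le> m + K" if m: "tpow (int m) x \<in> U" for x m
    proof (cases "x \<notin> V' \<and> \<gamma> x \<in> V'")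
      case False
      then show ?thesis using insert.prems(5)[OF m] by (auto simp: n'_def)
    next
      case True
      have le: "n x \<le> m + K" by (rule insert.prems(5)[OF m])
      have eq: "\<gamma> x = tpow (int (n x) - int m) (tpow (int m) x)"
        using insert.prems(4)[of x] by simp
      have "n x \<le> m"
      proof (rule ccontr)
        assume "\<not> n x \<le> m"
        then have "\<gamma> x \<in> W" unfolding eq using le by (intro W_I[OF m]) simp_all
        then show False using True V'_sub by blast
      qed
      then have "tpow (int (m - n x)) (\<gamma> x) = tpow (int m) x"
        by (simp add: insert.prems(4)[of x] of_nat_diff)
      then have "n (\<gamma> x) \<le> m - n x + K" using m insert.prems(5) by simp
      then show ?thesis using \<open>n x \<le> m\<close> True by (simp add: n'_def)
    qed
    show "x \<in> W \<union> \<Union>\<V>" if x: "(\<delta> \<circ> \<gamma>) x \<noteq> x" for x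
    proof (rule ccontr)
      assume not: "x \<notin> W \<union> \<Union>\<V>"
      have "x \<notin> V'" using x \<delta>(4) by auto
      have "\<gamma> x = x"
      proof (rule ccontr)
        assume "\<gamma> x \<noteq> x"
        then have "x \<in> V0" using insert.prems(6)[of x] not by (auto simp: V0_def)
        then have "x \<in> V" "\<gamma> x \<in> V" using \<open>x \<notin> V'\<close> by (auto simp: V'_def V0_def)
        moreover have "n x \<noteq> 0" using \<open>\<gamma> x \<noteq> x\<close> insert.prems(4)[of x] by (intro notI) simp
        ultimately show False
          using smallV[of x "int (n x)"] bound[of x] insert.prems(4)[of x] by simp
      qed
      moreover have "x \<notin> \<gamma> ` V'" using \<open>\<gamma> x = x\<close> \<open>x \<notin> V'\<close> inj by (metis imageE)
      ultimately show False using x \<delta>(5) \<open>x \<notin> V'\<close> by simp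
    qed
  qed
  then have "\<delta> \<circ> (\<delta> \<circ> \<gamma>) \<in> displaceable_generated"
    using generate.eng[OF \<delta>_gen] by simp
  moreover have "\<delta> \<circ> (\<delta> \<circ> \<gamma>) = \<gamma>" using \<delta>(2) by auto
  ultimately show ?case by simp
qed

text \<open>Choose first \<open>U\<close> so small that \<open>W\<close> occupies at most a third of a tower over \<open>U\<close>, then the bound \<open>N\<close>
  for its hitting times, and only then a finite cover by sets that are small with respect to
  \<open>N + K\<close>.\<close>

lemma positive_generated:
  assumes "\<gamma> \<in> full" "\<And>x. \<exists>n\<le>K. \<gamma> x = tpow (int n) x"
  shows "\<gamma> \<in> displaceable_generated"
proof -
  obtain n where n: "\<And>x. n x \<le> K" "\<And>x. \<gamma> x = tpow (int (n x)) x" using assms(2) by metis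
  obtain x0 :: 'a where True by simp
  obtain U where U: "open U" "closed U" "x0 \<in> U"
    "\<forall>y\<in>U. \<forall>j. 0 < j \<longrightarrow> j \<le> int (3 * K + 3) \<longrightarrow> tpow j y \<notin> U"
    using small_neighbourhood[of x0 "3 * K + 3"] by blast
  have "U \<noteq> {}" using U(3) by blast
  obtain N where N: "\<And>x. \<exists>m\<le>N. tpow (int m) x \<in> U"
    using bounded_hitting_time[OF U(1) \<open>U \<noteq> {}\<close>] by blast
  define W where "W = (\<Union>j\<in>{0..int K}. tpow (- j) -` U)"
  have W: "open W" "closed W"
    unfolding W_def using U(1,2) open_tpow closed_tpow by (auto intro!: open_UN closed_UN)
  define \<B> where "\<B> = {V. open V \<and> closed V \<and>
    (\<forall>y\<in>V. \<forall>j. 0 < j \<longrightarrow> j \<le> int (3 * (N + K) + 3) \<longrightarrow> tpow j y \<notin> V)}"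
  have "x \<in> \<Union>\<B>" for x
    using small_neighbourhood[of x "3 * (N + K) + 3"] unfolding \<B>_def by blast
  then have "UNIV \<subseteq> \<Union>\<B>" by blast
  then obtain \<V> where \<V>: "\<V> \<subseteq> \<B>" "finite \<V>" "UNIV \<subseteq> \<Union>\<V>"
    by (rule compactE[OF compact_UNIV]) (auto simp: \<B>_def)
  show ?thesis
  proof (rule small_support_generated[where U = U and K = K and W = W and \<V> = \<V> and N = N and n = n])
    show "tpow j y \<notin> U" if "y \<in> U" "0 < j" "j \<le> 3 * int K + 3" for y j
      using U(4) that by simp
    show "open V \<and> closed V" if "V \<in> \<V>" for V using \<V>(1) that by (auto simp: \<B>_def)
    show "tpow j y \<notin> V" if "V \<in> \<V>" "y \<in> V" "0 < j" "j \<le> 3 * int (N + K) + 3" for V y j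
    proof -
      have "V \<in> \<B>" using \<V>(1) that(1) by blast
      then show ?thesis using that by (simp add: \<B>_def)
    qed
    show "n x \<le> m + K" for x m using n(1)[of x] by simp
    show "x \<in> W \<union> \<Union>\<V>" for x using \<V>(3) by blast
  qed (use W N \<V>(2) assms(1) n(2) W_def in auto)
qed

text \<open>If the exponents of \<open>\<gamma>\<close> are at least \<open>-B\<close>, then both \<open>T\<^sup>B\<close> and \<open>T\<^sup>B \<circ> \<gamma>\<close> only move points
  forward.\<close>

lemma full_group_displaceable_generated:
  "full \<subseteq> displaceable_generated"
proof
  fix \<gamma> assume \<gamma>: "\<gamma> \<in> full"
  obtain J where J: "finite J" "\<And>x. \<exists>k\<in>J. \<exists>G. open G \<and> x \<in> G \<and> (\<forall>y\<in>G. \<gamma> y = tpow k y)"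
    using full_group_finite[OF \<gamma>] by metis
  define B where "B = Max ((\<lambda>j. nat \<bar>j\<bar>) ` insert 0 J)"
  have B: "nat \<bar>j\<bar> \<le> B" if "j \<in> J" for j
    unfolding B_def using J(1) that by (intro Max_ge) auto
  have pos: "tpow (int B) \<in> displaceable_generated"
    by (rule positive_generated[OF tpow_in_full, of B]) auto
  have "tpow (int B) \<circ> \<gamma> \<in> displaceable_generated"
  proof (rule positive_generated[OF full_comp[OF tpow_in_full \<gamma>]])
    fix x
    obtain k where k: "k \<in> J" "\<gamma> x = tpow k x" using J(2)[of x] by blast
    have "(tpow (int B) \<circ> \<gamma>) x = tpow (int (nat (int B + k))) x" "nat (int B + k) \<le> 2 * B"
      using k B[OF k(1)] by auto
    then show "\<exists>n\<le>2 * B. (tpow (int B) \<circ> \<gamma>) x = tpow (int n) x" by blast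
  qed
  moreover have "hinv (tpow (int B)) \<in> displaceable_generated"
    by (rule group.generate_m_inv_closed[OF group_homeo_group _ pos])
       (auto simp: displaceable_def full_group_carrier)
  ultimately have "hinv (tpow (int B)) \<circ> (tpow (int B) \<circ> \<gamma>) \<in> displaceable_generated"
    using generate.eng by fastforce
  moreover have "hinv (tpow (int B)) \<circ> (tpow (int B) \<circ> \<gamma>) = \<gamma>"
    using homeo_groupD(1)[OF tpow_in_carrier] by auto
  ultimately show "\<gamma> \<in> displaceable_generated" by simp
qed

section \<open>Commutators of displaceable elements\<close>

lemma funpow_full: "g \<in> full \<Longrightarrow> g ^^ n \<in> full"
  by (induction n) (use tpow_in_full[of 0] in \<open>auto simp: full_comp tpow_def\<close>)

lemma hinv_funpow:
  assumes "g \<in> full"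
  shows "hinv (g ^^ n) = hinv g ^^ n"
proof (rule hinv_eqI)
  show "g ^^ n \<in> carrier homeo_group" by (rule full_group_carrier[OF funpow_full[OF assms]])
  show "(g ^^ n) ((hinv g ^^ n) x) = x" for x
  proof (induction n arbitrary: x)
    case (Suc n)
    have "(g ^^ Suc n) ((hinv g ^^ Suc n) x) = (g ^^ n) (g (hinv g ((hinv g ^^ n) x)))"
      by (simp add: funpow_swap1)
    then show ?case using homeo_groupD(2)[OF full_group_carrier[OF assms]] Suc.IH by simp
  qed simp
qed

lemma hinv_tpow: "hinv (tpow k) = tpow (- k)"
  by (rule hinv_eqI[OF tpow_in_carrier]) simp

lemma commutator_in_derived:
  assumes "g \<in> full" "h \<in> full"
  shows "g \<circ> h \<circ> hinv g \<circ> hinv h \<in> derived homeo_group full"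
  unfolding derived_def by (rule generate.incl) (use assms in auto)

lemma derived_subset_full: "derived homeo_group full \<subseteq> full"
  by (rule group.derived_incl[OF group_homeo_group subset_refl subgroup_full])

text \<open>Let \<open>u\<close> be the Koopman operator of \<open>g\<close>, and \<open>E\<close>, \<open>D\<close> those of the commutators \<open>e\<close>, \<open>d\<close>.  The
  element \<open>e\<close> acts as \<open>g\<close> on the support \<open>Y\<close> of \<open>g\<close> and as a conjugate of \<open>g\<^sup>-\<^sup>1\<close> on \<open>T\<^sup>2\<^sup>m Y\<close>;
  likewise \<open>d\<close> acts as \<open>g\<^sup>n\<close> on \<open>Y\<close> and as a conjugate of \<open>g\<^sup>-\<^sup>n\<close> on \<open>T\<^sup>m Y\<close>.  The two conjugates have
  supports disjoint from each other and from \<open>Y\<close>, so they disappear from the product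
  \<open>(E - 1) (D - 1)\<close>, which equals \<open>(u - 1) (u\<^sup>n - 1)\<close>.  The lemma is this identity without the
  constant term, applied to a function.\<close>

lemma displaced_commutator_identity:
  fixes f :: "'a \<Rightarrow> complex" and n :: nat
  assumes g: "g \<in> full"
    and m: "\<And>x. g x \<noteq> x \<Longrightarrow> g (tpow m x) = tpow m x \<and> g (tpow (2 * m) x) = tpow (2 * m) x"
  defines "e \<equiv> g \<circ> tpow (2 * m) \<circ> hinv g \<circ> hinv (tpow (2 * m))"
    and "d \<equiv> (g ^^ n) \<circ> tpow m \<circ> hinv (g ^^ n) \<circ> hinv (tpow m)"
  shows "f (hinv d (hinv e x)) - f (hinv e x) - f (hinv d x) =
    f ((hinv g ^^ Suc n) x) - f ((hinv g ^^ n) x) - f (hinv g x)"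
proof -
  define q where "q = hinv g"
  note gc = full_group_carrier[OF g]
  have gq: "g (q y) = y" "q (g y) = y" for y
    unfolding q_def using homeo_groupD[OF gc] by auto
  have gqn: "(g ^^ n) ((q ^^ n) y) = y" "(q ^^ n) ((g ^^ n) y) = y" for y
    using homeo_groupD(1,2)[OF full_group_carrier[OF funpow_full[OF g, of n]]]
    by (simp_all add: hinv_funpow[OF g] q_def)
  have e: "hinv e = tpow (2 * m) \<circ> g \<circ> tpow (- (2 * m)) \<circ> q"
  proof (rule hinv_eqI)
    show "e \<in> carrier homeo_group"
      unfolding e_def by (intro full_group_carrier full_comp full_inv tpow_in_full g)
  qed (simp add: e_def hinv_tpow gq flip: q_def)
  have d: "hinv d = tpow m \<circ> (g ^^ n) \<circ> tpow (- m) \<circ> (q ^^ n)"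
  proof (rule hinv_eqI)
    show "d \<in> carrier homeo_group"
      unfolding d_def by (intro full_group_carrier full_comp full_inv tpow_in_full funpow_full g)
  qed (simp add: d_def hinv_tpow gqn hinv_funpow[OF g] flip: q_def)
  have m': "g (tpow (- m) y) = tpow (- m) y" "g (tpow (- (2 * m)) y) = tpow (- (2 * m)) y"
    if "g y \<noteq> y" for y
    using m[of "tpow (- m) y"] m[of "tpow (- (2 * m)) y"] that by auto
  have fix_q: "q y = y" if "g y = y" for y using that gq(2) by metis
  have move_q: "g (q y) \<noteq> q y" if "g y \<noteq> y" for y using that gq by metis
  have fix_gn: "(g ^^ k) y = y" if "g y = y" for k y using that by (induction k) auto
  have fix_qn: "(q ^^ k) y = y" if "g y = y" for k y using fix_q[OF that] by (induction k) auto
  have move_qn: "g ((q ^^ k) y) \<noteq> (q ^^ k) y" if "g y \<noteq> y" for k y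
    using that move_q by (induction k) auto
  show ?thesis
  proof (cases "g x = x")
    case False
    have d_moved: "hinv d y = (q ^^ n) y" if "g y \<noteq> y" for y
      using m'(1)[OF move_qn[OF that, of n]] by (simp add: d fix_gn)
    have "hinv e x = q x" using m'(2)[OF move_q[OF False]] by (simp add: e)
    then show ?thesis
      using False move_q[OF False] by (simp add: d_moved funpow_swap1 flip: q_def)
  next
    case True
    have "f (hinv d (hinv e x)) - f (hinv e x) - f (hinv d x) = - f x"
    proof (cases "g (tpow (- (2 * m)) x) = tpow (- (2 * m)) x")
      case fixed: True
      then have "hinv e x = x" using True by (simp add: e fix_q)
      then show ?thesis by simp
    next
      case False
      have d_fixed: "hinv d z = z" if z: "g (tpow (- (2 * m)) z) \<noteq> tpow (- (2 * m)) z" for z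
      proof -
        have "g z = z" "g (tpow (- m) z) = tpow (- m) z" using m[OF z] by auto
        then show ?thesis by (simp add: d fix_gn fix_qn)
      qed
      have "tpow (- (2 * m)) (hinv e x) = g (tpow (- (2 * m)) x)"
        using True by (simp add: e fix_q)
      then have "g (tpow (- (2 * m)) (hinv e x)) \<noteq> tpow (- (2 * m)) (hinv e x)"
        using False gq(2) by metis
      then show ?thesis using False by (simp add: d_fixed)
    qed
    then show ?thesis using fix_q[OF True] fix_qn[OF True, of n] by (simp flip: q_def)
  qed
qed

end


section \<open>Operators on square-integrable functions\<close>

lemma L2_fun_add:
  assumes "f \<in> L2_fun M" "g \<in> L2_fun M"
  shows "(\<lambda>x. f x + g x) \<in> L2_fun M"
proof -
  have [measurable]: "f \<in> borel_measurable M" "g \<in> borel_measurable M"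
    using assms by (auto simp: L2_fun_def)
  have "integrable M (\<lambda>x. 2 * (cmod (f x))\<^sup>2 + 2 * (cmod (g x))\<^sup>2)"
    using assms by (auto simp: L2_fun_def)
  then have "integrable M (\<lambda>x. (cmod (f x + g x))\<^sup>2)"
  proof (rule Bochner_Integration.integrable_bound)
    have "(cmod (f x + g x))\<^sup>2 \<le> 2 * (cmod (f x))\<^sup>2 + 2 * (cmod (g x))\<^sup>2" for x
    proof -
      have "(cmod (f x + g x))\<^sup>2 \<le> (cmod (f x) + cmod (g x))\<^sup>2"
        by (intro power_mono norm_triangle_ineq) auto
      also have "\<dots> \<le> 2 * (cmod (f x))\<^sup>2 + 2 * (cmod (g x))\<^sup>2"
        using sum_squares_bound[of "cmod (f x)" "cmod (g x)"] by (simp add: power2_sum)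
      finally show ?thesis .
    qed
    then show "AE x in M. norm ((cmod (f x + g x))\<^sup>2)
        \<le> norm (2 * (cmod (f x))\<^sup>2 + 2 * (cmod (g x))\<^sup>2)"
      by simp
  qed simp
  then show ?thesis by (simp add: L2_fun_def)
qed

lemma L2_fun_scale:
  assumes "f \<in> L2_fun M"
  shows "(\<lambda>x. c * f x) \<in> L2_fun M"
  using assms by (auto simp: L2_fun_def norm_mult power_mult_distrib)

lemma hcarrier_L2: "hcarrier (L2 M) = L2_class M ` L2_fun M"
  by (simp add: L2_def)

lemma L2_class_in_carrier: "f \<in> L2_fun M \<Longrightarrow> L2_class M f \<in> hcarrier (L2 M)"
  by (simp add: hcarrier_L2)

lemma hnorm_L2_class:
  assumes "f \<in> L2_fun M"
  shows "hnorm (L2 M) (L2_class M f) = sqrt (\<integral>x. (cmod (f x))\<^sup>2 \<partial>M)"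
proof -
  have "hinner (L2 M) (L2_class M f) (L2_class M f) = (\<integral>x. complex_of_real ((cmod (f x))\<^sup>2) \<partial>M)"
    unfolding L2_inner_class[OF assms assms] by (simp only: complex_norm_square)
  also have "\<dots> = complex_of_real (\<integral>x. (cmod (f x))\<^sup>2 \<partial>M)" by (rule integral_complex_of_real)
  finally show ?thesis by (simp add: hnorm_def)
qed

text \<open>Operators on classes are handled through transformations of functions, so that identities between
  operators become pointwise identities between functions.\<close>

definition implements ::
  "'a measure \<Rightarrow> (('a \<Rightarrow> complex) set \<Rightarrow> ('a \<Rightarrow> complex) set) \<Rightarrow>
   (('a \<Rightarrow> complex) \<Rightarrow> 'a \<Rightarrow> complex) \<Rightarrow> bool" where
  "implements M a F \<longleftrightarrow>
     (\<forall>f\<in>L2_fun M. F f \<in> L2_fun M \<and> a (L2_class M f) = L2_class M (F f))"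

lemma implements_add:
  assumes "implements M a F" "implements M b G"
  shows "implements M (op_add (L2 M) a b) (\<lambda>f x. F f x + G f x)"
  using assms unfolding implements_def
  by (auto simp: op_add_def L2_class_in_carrier L2_add_class L2_fun_add)

lemma implements_scale:
  assumes "implements M a F"
  shows "implements M (op_scale (L2 M) c a) (\<lambda>f x. c * F f x)"
  using assms unfolding implements_def
  by (auto simp: op_scale_def L2_class_in_carrier L2_scale_class L2_fun_scale)

lemma implements_compose:
  assumes "implements M a F" "implements M b G"
  shows "implements M (compose (hcarrier (L2 M)) a b) (\<lambda>f. F (G f))"
  using assms unfolding implements_def by (auto simp: compose_def L2_class_in_carrier)

lemma op_norm_leI:
  assumes a: "implements M a F"
    and bound: "\<And>f. f \<in> L2_fun M \<Longrightarrow>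
      hnorm (L2 M) (L2_class M (F f)) \<le> c * hnorm (L2 M) (L2_class M f)"
    and c: "0 \<le> c"
  shows "op_norm (L2 M) a \<le> c"
  unfolding op_norm_def
proof (rule cSUP_least)
  have zero: "(\<lambda>x. 0) \<in> L2_fun M" by (simp add: L2_fun_def)
  have "hnorm (L2 M) (L2_class M (\<lambda>x. 0)) \<le> 1" unfolding hnorm_L2_class[OF zero] by simp
  then show "{x \<in> hcarrier (L2 M). hnorm (L2 M) x \<le> 1} \<noteq> {}"
    using L2_class_in_carrier[OF zero] by blast
  fix u assume "u \<in> {x \<in> hcarrier (L2 M). hnorm (L2 M) x \<le> 1}"
  then obtain f where f: "f \<in> L2_fun M" "u = L2_class M f" "hnorm (L2 M) u \<le> 1"
    by (auto simp: hcarrier_L2)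
  then have "hnorm (L2 M) (a u) \<le> c * hnorm (L2 M) u"
    using a bound[OF f(1)] by (simp add: implements_def)
  also have "\<dots> \<le> c" using f(3) c by (simp add: mult_left_le)
  finally show "hnorm (L2 M) (a u) \<le> c" .
qed

section \<open>The Koopman representation\<close>

locale cantor_minimal_measure = cantor_minimal_system T + prob_space M
  for T :: "'a::topological_space \<Rightarrow> 'a" and M :: "'a measure" +
  assumes sets_M: "sets M = sets borel"
    and invariant_T: "distr M M T = M"
begin

lemma space_M [simp]: "space M = UNIV"
  using sets_eq_imp_space_eq[OF sets_M] by simp

lemma homeo_measurable:
  assumes "g \<in> carrier homeo_group"
  shows "g \<in> measurable M M"
  unfolding measurable_cong_sets[OF sets_M sets_M]
  by (rule borel_measurable_continuous_onI[OF homeo_groupD(4)[OF assms]])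

lemma tpow_measurable [measurable]: "tpow k \<in> measurable M M"
  by (rule homeo_measurable[OF tpow_in_carrier])

lemma distr_tpow: "distr M M (tpow k) = M"
proof -
  have nat: "distr M M (tpow (int n)) = M" for n
  proof (induction n)
    case 0
    have "distr M M (tpow 0) = distr M M (\<lambda>x. x)" by (rule distr_cong) auto
    then show ?case by (simp add: distr_id)
  next
    case (Suc n)
    have "distr M M (tpow (int (Suc n))) = distr M M (tpow 1 \<circ> tpow (int n))"
      by (rule distr_cong) auto
    also have "\<dots> = distr (distr M M (tpow (int n))) M (tpow 1)"
      by (rule distr_distr[symmetric]) measurable
    also have "\<dots> = distr M M T"
      unfolding Suc.IH by (rule distr_cong) (auto simp: tpow_1)
    finally show ?case by (simp add: invariant_T)
  qed
  show ?thesis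
  proof (cases "k \<ge> 0")
    case True
    then show ?thesis using nat[of "nat k"] by simp
  next
    case False
    then have "distr M M (tpow (- k)) = M" using nat[of "nat (- k)"] by simp
    then have "distr M M (tpow k) = distr (distr M M (tpow (- k))) M (tpow k)" by simp
    also have "\<dots> = distr M M (tpow k \<circ> tpow (- k))"
      by (rule distr_distr) measurable
    also have "\<dots> = distr M M (\<lambda>x. x)" by (rule distr_cong) auto
    finally show ?thesis by (simp add: distr_id)
  qed
qed

lemma open_sets: "open S \<Longrightarrow> S \<in> sets M"
  by (simp add: sets_M)

text \<open>On each of finitely many clopen pieces \<open>g\<close> is a power of \<open>T\<close>, which preserves the measure, and
  the images of the pieces are again disjoint and cover the space.\<close>

lemma distr_full:
  assumes g: "g \<in> full"
  shows "distr M M g = M"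
proof (rule measure_eqI)
  note gc = full_group_carrier[OF g]
  note [measurable] = homeo_measurable[OF gc]
  show "sets (distr M M g) = sets M" by simp
  fix E assume "E \<in> sets (distr M M g)"
  then have E [measurable]: "E \<in> sets M" by simp
  define \<Gamma> where "\<Gamma> k = {x. g x = tpow k x}" for k
  have open_\<Gamma>: "open (\<Gamma> k)" for k
    unfolding \<Gamma>_def by (rule open_level[OF g])
  have \<Gamma>: "\<Gamma> k \<in> sets M" "g ` \<Gamma> k \<in> sets M" for k
    by (rule open_sets[OF open_\<Gamma>]) (rule open_sets[OF open_homeo_group(2)[OF gc open_\<Gamma>]])
  have disj: "\<Gamma> k \<inter> \<Gamma> l = {}" if "k \<noteq> l" for k l
    using that by (auto simp: \<Gamma>_def tpow_inj_exp)
  have inj: "g x = g y \<Longrightarrow> x = y" for x y using homeo_groupD(1)[OF gc] by metis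
  from full_group_finite[OF g] obtain K where K_fin: "finite K"
    and K_loc: "\<forall>x. \<exists>k\<in>K. \<exists>G. open G \<and> x \<in> G \<and> (\<forall>y\<in>G. g y = tpow k y)"
    by (elim exE conjE)
  have "\<exists>k\<in>K. x \<in> \<Gamma> k" for x
  proof -
    obtain k G where "k \<in> K" "x \<in> G" "\<forall>y\<in>G. g y = tpow k y" using K_loc[rule_format, of x] by blast
    then show ?thesis by (intro bexI[of _ k]) (simp_all add: \<Gamma>_def)
  qed
  note K = K_fin this
  have piece: "tpow k -` (g ` \<Gamma> k \<inter> E) = \<Gamma> k \<inter> g -` E" for k
  proof (intro equalityI subsetI)
    fix x assume "x \<in> tpow k -` (g ` \<Gamma> k \<inter> E)"
    then obtain y where y: "y \<in> \<Gamma> k" "tpow k x = g y" "g y \<in> E" by auto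
    then have "tpow (- k) (tpow k x) = tpow (- k) (tpow k y)" by (simp add: \<Gamma>_def)
    then have "x = y" by simp
    then show "x \<in> \<Gamma> k \<inter> g -` E" using y by simp
  next
    fix x assume "x \<in> \<Gamma> k \<inter> g -` E"
    then show "x \<in> tpow k -` (g ` \<Gamma> k \<inter> E)" by (auto simp: \<Gamma>_def)
  qed
  have gE: "g -` E \<in> sets M" using measurable_sets[OF homeo_measurable[OF gc] E] by simp
  have "emeasure (distr M M g) E = emeasure M (g -` E)"
    by (simp add: emeasure_distr)
  also have "g -` E = (\<Union>k\<in>K. \<Gamma> k \<inter> g -` E)" using K(2) by blast
  also have "emeasure M \<dots> = (\<Sum>k\<in>K. emeasure M (\<Gamma> k \<inter> g -` E))"
  proof (rule sum_emeasure[symmetric])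
    show "disjoint_family_on (\<lambda>k. \<Gamma> k \<inter> g -` E) K"
      unfolding disjoint_family_on_def using disj by blast
  qed (use \<Gamma> gE K(1) in auto)
  also have "\<dots> = (\<Sum>k\<in>K. emeasure M (g ` \<Gamma> k \<inter> E))"
  proof (rule sum.cong)
    fix k
    have "emeasure M (tpow k -` (g ` \<Gamma> k \<inter> E)) = emeasure (distr M M (tpow k)) (g ` \<Gamma> k \<inter> E)"
      using \<Gamma> E by (subst emeasure_distr) auto
    then show "emeasure M (\<Gamma> k \<inter> g -` E) = emeasure M (g ` \<Gamma> k \<inter> E)"
      by (simp only: piece distr_tpow)
  qed simp
  also have "\<dots> = emeasure M (\<Union>k\<in>K. g ` \<Gamma> k \<inter> E)"
  proof (rule sum_emeasure)
    show "disjoint_family_on (\<lambda>k. g ` \<Gamma> k \<inter> E) K"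
      unfolding disjoint_family_on_def using disj inj by fast
  qed (use \<Gamma> E K(1) in auto)
  also have "(\<Union>k\<in>K. g ` \<Gamma> k \<inter> E) = E"
  proof (intro equalityI subsetI)
    fix y assume "y \<in> E"
    moreover obtain k where "k \<in> K" "hinv g y \<in> \<Gamma> k" using K(2) by blast
    moreover have "y = g (hinv g y)" using homeo_groupD(2)[OF gc] by simp
    ultimately show "y \<in> (\<Union>k\<in>K. g ` \<Gamma> k \<inter> E)" by blast
  qed auto
  finally show "emeasure (distr M M g) E = emeasure M E" .
qed

lemma L2_fun_comp:
  assumes g: "g \<in> full" and f: "f \<in> L2_fun M"
  shows "f \<circ> g \<in> L2_fun M" "hnorm (L2 M) (L2_class M (f \<circ> g)) = hnorm (L2 M) (L2_class M f)"
proof -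
  note [measurable] = homeo_measurable[OF full_group_carrier[OF g]]
  have [measurable]: "f \<in> borel_measurable M" and "integrable M (\<lambda>x. (cmod (f x))\<^sup>2)"
    using f by (auto simp: L2_fun_def)
  then have "integrable (distr M M g) (\<lambda>x. (cmod (f x))\<^sup>2)" by (simp add: distr_full[OF g])
  then have "integrable M (\<lambda>x. (cmod (f (g x)))\<^sup>2)" by (subst (asm) integrable_distr_eq) auto
  then show fg: "f \<circ> g \<in> L2_fun M" by (simp add: L2_fun_def)
  have "(\<integral>x. (cmod (f x))\<^sup>2 \<partial>distr M M g) = (\<integral>x. (cmod (f (g x)))\<^sup>2 \<partial>M)"
    by (rule integral_distr) measurable
  then show "hnorm (L2 M) (L2_class M (f \<circ> g)) = hnorm (L2 M) (L2_class M f)"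
    by (simp add: hnorm_L2_class[OF f] hnorm_L2_class[OF fg] distr_full[OF g])
qed

lemma koopman_implements:
  assumes g: "g \<in> full"
  shows "implements M (koopman M g) (\<lambda>f. f \<circ> hinv g)"
  unfolding implements_def
proof (intro ballI conjI)
  fix f assume f: "f \<in> L2_fun M"
  note h = full_inv[OF g]
  show "f \<circ> hinv g \<in> L2_fun M" by (rule L2_fun_comp[OF h f])
  have "AE x in distr M M (hinv g). L2_rep (L2_class M f) x = f x"
    unfolding distr_full[OF h] by (rule L2_rep_class(2)[OF f])
  then have "AE x in M. L2_rep (L2_class M f) (hinv g x) = f (hinv g x)"
    by (rule AE_distrD[OF homeo_measurable[OF full_group_carrier[OF h]]])
  then have "L2_class M (L2_rep (L2_class M f) \<circ> hinv g) = L2_class M (f \<circ> hinv g)"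
    by (intro L2_class_eqI) simp
  then show "koopman M g (L2_class M f) = L2_class M (f \<circ> hinv g)"
    by (simp add: koopman_def L2_class_in_carrier[OF f])
qed

lemma koopman_class:
  "g \<in> full \<Longrightarrow> f \<in> L2_fun M \<Longrightarrow> koopman M g (L2_class M f) = L2_class M (f \<circ> hinv g)"
  using koopman_implements by (simp add: implements_def)

lemma koopman_extensional: "u \<notin> hcarrier (L2 M) \<Longrightarrow> koopman M g u = undefined"
  by (simp add: koopman_def)

lemma koopman_bounded:
  assumes g: "g \<in> full"
  shows "koopman M g \<in> bounded_ops (L2 M)"
proof -
  note h = full_inv[OF g]
  note kc = koopman_class[OF g] and L2c = L2_fun_comp(1)[OF h]
  have "koopman M g \<in> hcarrier (L2 M) \<rightarrow>\<^sub>E hcarrier (L2 M)"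
    using koopman_extensional by (auto simp: hcarrier_L2 kc L2c PiE_iff extensional_def)
  moreover have "koopman M g (hadd (L2 M) u v) = hadd (L2 M) (koopman M g u) (koopman M g v)"
    if "u \<in> hcarrier (L2 M)" "v \<in> hcarrier (L2 M)" for u v
    using that by (auto simp: hcarrier_L2 kc L2c L2_add_class L2_fun_add comp_def
        L2c[unfolded comp_def])
  moreover have "koopman M g (hscale (L2 M) c u) = hscale (L2 M) c (koopman M g u)"
    if "u \<in> hcarrier (L2 M)" for c u
    using that by (auto simp: hcarrier_L2 kc L2c L2_scale_class L2_fun_scale comp_def
        L2c[unfolded comp_def])
  moreover have "hnorm (L2 M) (koopman M g u) \<le> 1 * hnorm (L2 M) u"
    if "u \<in> hcarrier (L2 M)" for u
    using that by (auto simp: hcarrier_L2 kc L2_fun_comp(2)[OF h])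
  ultimately show ?thesis
    unfolding bounded_ops_def by (intro CollectI conjI ballI allI exI[of _ 1]) assumption+
qed

lemma koopman_comp:
  assumes "g \<in> full" "h \<in> full"
  shows "koopman M (g \<circ> h) = compose (hcarrier (L2 M)) (koopman M g) (koopman M h)"
proof
  fix u
  have inv: "hinv (g \<circ> h) = hinv h \<circ> hinv g"
    using assms[THEN full_group_carrier]
    by (intro hinv_eqI full_group_carrier[OF full_comp[OF assms]]) (simp add: homeo_groupD(2))
  show "koopman M (g \<circ> h) u = compose (hcarrier (L2 M)) (koopman M g) (koopman M h) u"
  proof (cases "u \<in> hcarrier (L2 M)")
    case True
    then obtain f where "f \<in> L2_fun M" "u = L2_class M f" by (auto simp: hcarrier_L2)
    then show ?thesis using True assms
      by (simp add: compose_def koopman_class full_comp full_inv L2_fun_comp(1) inv comp_assoc)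
  next
    case False
    then show ?thesis by (simp add: compose_def koopman_extensional)
  qed
qed

section \<open>Algebras containing the image of the commutator subgroup\<close>

context
  fixes A
  assumes A: "cstar_subalgebra (L2 M) A" and derived_A: "koopman M ` derived homeo_group full \<subseteq> A"
begin

lemma A_add: "a \<in> A \<Longrightarrow> b \<in> A \<Longrightarrow> op_add (L2 M) a b \<in> A"
  and A_scale: "a \<in> A \<Longrightarrow> op_scale (L2 M) c a \<in> A"
  and A_compose: "a \<in> A \<Longrightarrow> b \<in> A \<Longrightarrow> compose (hcarrier (L2 M)) a b \<in> A"
  and A_closed: "a \<in> bounded_ops (L2 M) \<Longrightarrow> (\<And>\<epsilon>. \<epsilon> > 0 \<Longrightarrow> \<exists>b\<in>A. op_dist (L2 M) a b < \<epsilon>) \<Longrightarrow> a \<in> A"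
  using A unfolding cstar_subalgebra_def by blast+

lemma koopman_derived: "g \<in> derived homeo_group full \<Longrightarrow> koopman M g \<in> A"
  using derived_A by blast

lemma koopman_id: "koopman M id \<in> A"
  using generate.one[of homeo_group "derived_set homeo_group full"]
  by (intro koopman_derived) (simp add: derived_def)

text \<open>Modulo \<open>A\<close> the powers of the Koopman operator \<open>u\<close> of \<open>g\<close> are additive, because
  \<open>u\<^sup>n\<^sup>+\<^sup>1 - u\<^sup>n - u = E D - E - D\<close> with operators \<open>E\<close>, \<open>D\<close> of commutators; hence \<open>u\<^sup>n\<close> is congruent to
  \<open>n u\<close>.\<close>

lemma power_defect_in_A:
  assumes "displaceable g"
  shows "\<exists>a\<in>A. implements M a (\<lambda>f x. f ((hinv g ^^ n) x) - of_nat n * f (hinv g x))"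
proof (induction n)
  case 0
  have "id \<in> full" using subgroup.one_closed[OF subgroup_full] by simp
  moreover have "hinv id = (id :: 'a \<Rightarrow> 'a)"
    using hinv_eqI[of id id] \<open>id \<in> full\<close> full_group_carrier by auto
  ultimately have "implements M (koopman M id) (\<lambda>f. f)"
    using koopman_implements[of id] by simp
  then show ?case using koopman_id by auto
next
  case (Suc n)
  obtain m where g: "g \<in> full" and
    m: "\<And>x. g x \<noteq> x \<Longrightarrow> g (tpow m x) = tpow m x \<and> g (tpow (2 * m) x) = tpow (2 * m) x"
    using assms unfolding displaceable_def by blast
  define e where "e = g \<circ> tpow (2 * m) \<circ> hinv g \<circ> hinv (tpow (2 * m))"
  define d where "d = (g ^^ n) \<circ> tpow m \<circ> hinv (g ^^ n) \<circ> hinv (tpow m)"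
  have "e \<in> derived homeo_group full" "d \<in> derived homeo_group full"
    unfolding e_def d_def by (intro commutator_in_derived funpow_full tpow_in_full g)+
  then have E: "koopman M e \<in> A" "implements M (koopman M e) (\<lambda>f. f \<circ> hinv e)"
    and D: "koopman M d \<in> A" "implements M (koopman M d) (\<lambda>f. f \<circ> hinv d)"
    using koopman_derived koopman_implements derived_subset_full by blast+
  obtain a where a: "a \<in> A"
    "implements M a (\<lambda>f x. f ((hinv g ^^ n) x) - of_nat n * f (hinv g x))"
    using Suc.IH by blast
  let ?ED = "compose (hcarrier (L2 M)) (koopman M e) (koopman M d)"
  let ?a = "op_add (L2 M) (op_add (L2 M) a ?ED)
    (op_scale (L2 M) (- 1) (op_add (L2 M) (koopman M e) (koopman M d)))"
  have in_A: "?a \<in> A" using a E D by (intro A_add A_scale A_compose)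
  have impl: "implements M ?a (\<lambda>f x.
      f ((hinv g ^^ n) x) - of_nat n * f (hinv g x) + (f \<circ> hinv d \<circ> hinv e) x
      + (- 1) * ((f \<circ> hinv e) x + (f \<circ> hinv d) x))"
    by (intro implements_add implements_scale implements_compose[OF E(2) D(2)] a(2) E(2) D(2))
  have eq: "(\<lambda>f x.
      f ((hinv g ^^ n) x) - of_nat n * f (hinv g x) + (f \<circ> hinv d \<circ> hinv e) x
      + (- 1) * ((f \<circ> hinv e) x + (f \<circ> hinv d) x)) =
    (\<lambda>(f :: 'a \<Rightarrow> complex) x. f ((hinv g ^^ Suc n) x) - of_nat (Suc n) * f (hinv g x))"
  proof (intro ext)
    fix f :: "'a \<Rightarrow> complex" and x
    show "f ((hinv g ^^ n) x) - of_nat n * f (hinv g x) + (f \<circ> hinv d \<circ> hinv e) x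
      + (- 1) * ((f \<circ> hinv e) x + (f \<circ> hinv d) x) =
      f ((hinv g ^^ Suc n) x) - of_nat (Suc n) * f (hinv g x)"
      using displaced_commutator_identity[OF g m, of f n x, folded e_def d_def]
      by (simp add: algebra_simps del: funpow.simps)
  qed
  show ?case using impl in_A unfolding eq by (rule bexI)
qed

text \<open>As \<open>u\<^sup>n\<close> is isometric and \<open>u\<^sup>n - n u\<close> lies in \<open>A\<close>, the distance from \<open>u\<close> to \<open>A\<close> is at most the
  norm \<open>1 / n\<close> of \<open>u\<^sup>n / n\<close>, for every \<open>n\<close>.\<close>

lemma koopman_displaceable:
  assumes disp: "displaceable g"
  shows "koopman M g \<in> A"
proof (rule A_closed)
  have g: "g \<in> full" using disp by (simp add: displaceable_def)
  show "koopman M g \<in> bounded_ops (L2 M)" by (rule koopman_bounded[OF g])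
  fix \<epsilon> :: real assume "\<epsilon> > 0"
  then obtain n where n: "n > 0" "1 / real n < \<epsilon>"
    by (metis nat_approx_posE of_nat_0_less_iff zero_less_Suc)
  obtain a where a: "a \<in> A"
    "implements M a (\<lambda>f x. f ((hinv g ^^ n) x) - of_nat n * f (hinv g x))"
    using power_defect_in_A[OF disp] by blast
  let ?b = "op_scale (L2 M) (- (1 / of_nat n)) a"
  have "implements M (op_add (L2 M) (koopman M g) (op_scale (L2 M) (- 1) ?b))
    (\<lambda>f x. (f \<circ> hinv g) x
      + (- 1) * (- (1 / of_nat n) * (f ((hinv g ^^ n) x) - of_nat n * f (hinv g x))))"
    by (intro implements_add implements_scale koopman_implements g a(2))
  also have "(\<lambda>f x. (f \<circ> hinv g) x
      + (- 1) * (- (1 / of_nat n) * (f ((hinv g ^^ n) x) - of_nat n * f (hinv g x)))) =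
    (\<lambda>(f :: 'a \<Rightarrow> complex) x. 1 / of_nat n * (f \<circ> (hinv g ^^ n)) x)"
    using n(1) by (auto simp: fun_eq_iff field_simps)
  finally have diff: "implements M (op_add (L2 M) (koopman M g) (op_scale (L2 M) (- 1) ?b))
    (\<lambda>f x. 1 / of_nat n * (f \<circ> (hinv g ^^ n)) x)" .
  have "op_dist (L2 M) (koopman M g) ?b \<le> 1 / real n"
    unfolding op_dist_def
  proof (rule op_norm_leI[OF diff])
    fix f assume f: "f \<in> L2_fun M"
    note q = funpow_full[OF full_inv[OF g], of n]
    have fq: "f \<circ> (hinv g ^^ n) \<in> L2_fun M" by (rule L2_fun_comp(1)[OF q f])
    have "hnorm (L2 M) (L2_class M (\<lambda>x. 1 / of_nat n * (f \<circ> (hinv g ^^ n)) x))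
      = 1 / real n * hnorm (L2 M) (L2_class M (f \<circ> (hinv g ^^ n)))"
      unfolding hnorm_L2_class[OF L2_fun_scale[OF fq]] hnorm_L2_class[OF fq]
      by (simp add: norm_divide power_divide real_sqrt_divide)
    then show "hnorm (L2 M) (L2_class M (\<lambda>x. 1 / of_nat n * (f \<circ> (hinv g ^^ n)) x))
      \<le> 1 / real n * hnorm (L2 M) (L2_class M f)"
      by (simp add: L2_fun_comp(2)[OF q f])
  qed simp
  then show "\<exists>b\<in>A. op_dist (L2 M) (koopman M g) b < \<epsilon>"
    using n(2) A_scale[OF a(1)] by (intro bexI[of _ ?b]) auto
qed

lemma koopman_full_in_A:
  assumes "g \<in> full"
  shows "koopman M g \<in> A"
proof -
  have "g \<in> full \<and> koopman M g \<in> A" if "g \<in> displaceable_generated" for g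
    using that
  proof (induction rule: generate.induct)
    case one
    show ?case
      using koopman_id subgroup.one_closed[OF subgroup_full] unfolding one_homeo_group by blast
  next
    case (incl h)
    then show ?case using koopman_displaceable by (simp add: displaceable_def)
  next
    case (inv h)
    then have "displaceable (hinv h)" using displaceable_inv by simp
    then show ?case using koopman_displaceable by (simp add: displaceable_def)
  next
    case (eng h1 h2)
    then show ?case unfolding mult_homeo_group by (metis full_comp koopman_comp A_compose)
  qed
  then show ?thesis using full_group_displaceable_generated assms by blast
qed

end

lemma cstar_rep_derived:
  "cstar_rep (L2 M) (koopman M) full = cstar_rep (L2 M) (koopman M) (derived homeo_group full)"
proof -
  have "koopman M ` full \<subseteq> A \<longleftrightarrow> koopman M ` derived homeo_group full \<subseteq> A"
    if "cstar_subalgebra (L2 M) A" for A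
    using koopman_full_in_A[OF that] derived_subset_full by blast
  then show ?thesis unfolding cstar_rep_def cstar_generated_def by metis
qed

end

section \<open>The Cantor set\<close>

lemma compact_bool_sequences: "compact (UNIV :: (nat \<Rightarrow> bool) set)"
proof -
  have "compact_space (product_topology (\<lambda>_::nat. euclidean :: bool topology) UNIV)"
    unfolding compact_space_product_topology
    by (auto simp: compact_space_def finite_imp_compact)
  then show ?thesis by (simp add: euclidean_product_topology compact_space_def)
qed

theorem theorem3p5:
  fixes T :: "'a::topological_space \<Rightarrow> 'a" and M :: "'a measure"
  assumes "(UNIV :: 'a set) homeomorphic (UNIV :: (nat \<Rightarrow> bool) set)"
    and "minimal_homeo T"
    and "prob_space M"
    and "sets M = sets borel"
    and "distr M M T = M"
  shows "cstar_rep (L2 M) (koopman M) (topological_full_group T) =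
         cstar_rep (L2 M) (koopman M) (derived homeo_group (topological_full_group T))"
proof -
  obtain \<phi> :: "'a \<Rightarrow> nat \<Rightarrow> bool" and \<psi> where hom: "homeomorphism UNIV UNIV \<phi> \<psi>"
    using assms(1) unfolding homeomorphic_def by blast
  have inv: "\<psi> (\<phi> x) = x" "\<phi> (\<psi> y) = y" for x y
    using hom by (auto simp: homeomorphism_def)
  have cont: "continuous_on UNIV \<phi>" "continuous_on UNIV \<psi>"
    using hom by (auto simp: homeomorphism_def)
  have "compact (UNIV :: 'a set)"
    using compact_continuous_image[OF cont(2) compact_bool_sequences] hom
    by (simp add: homeomorphism_def)
  moreover have "\<exists>C. open C \<and> closed C \<and> x \<in> C \<and> y \<notin> C" if "x \<noteq> y" for x y :: 'a
  proof -
    have "\<phi> x \<noteq> \<phi> y" using \<open>x \<noteq> y\<close> inv(1) by metis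
    then obtain i where i: "\<phi> x i \<noteq> \<phi> y i" by (auto simp: fun_eq_iff)
    have "continuous_on UNIV (\<lambda>z. \<phi> z i)"
      using cont(1) by (rule continuous_on_product_then_coordinatewise)
    then have "open ((\<lambda>z. \<phi> z i) -` B)" for B
      by (rule open_vimage[OF discrete_topology_class.open_discrete])
    from this[of "{\<phi> x i}"] this[of "- {\<phi> x i}"] show ?thesis
      using i by (intro exI[of _ "(\<lambda>z. \<phi> z i) -` {\<phi> x i}"]) (auto simp: closed_def vimage_Compl)
  qed
  moreover have "infinite (UNIV :: 'a set)"
  proof
    assume "finite (UNIV :: 'a set)"
    then have "finite (range \<phi>)" by simp
    then have "finite (UNIV :: (nat \<Rightarrow> bool) set)" using hom by (simp add: homeomorphism_def)
    then have "finite (range (\<lambda>n m. m = (n :: nat)))"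
      by (rule rev_finite_subset[OF _ subset_UNIV])
    moreover have "inj (\<lambda>n m. m = (n :: nat))" by (auto simp: inj_def fun_eq_iff)
    ultimately show False by (simp add: finite_image_iff)
  qed
  ultimately interpret cantor_minimal_measure T M
    using assms by (simp add: cantor_minimal_measure_def cantor_minimal_system_def
        cantor_minimal_measure_axioms_def)
  show ?thesis by (rule cstar_rep_derived)
qed

end
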